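(* Let $d\ge2$, $n\ge1$, $m\ge1$ be integers, $N=d^n$, and let $t,f$ be integers with $0\le t<n$, $1\le f\le N$. For integers $k,p,q$ with $1\le k\le\min(f,d^t)$, $0\le p\le n-t-1$, $n-t\le q\le n$, put $\mu=\min\{d^t-k,\;k(d^{n-q}-1)\}$ and define $c(k,p,q)$ by: - if $t\ge\lfloor n/2\rfloor$ and $q=n-t$: $c=f(d^p-1)+(n-t-1-p)(d^{n-t}-d^{n-t-1})-d^{n-t-1}+d^p+d^t-k$; - if $t\ge\lfloor n/2\rfloor$ and $q>n-t$: $c=f(d^p-1)+(n-t-1-p)(d^{n-t}-d^{n-t-1})-d^{n-t-1}+d^{q-1}+\mu$; - if $p+1\le t\le\lfloor n/2\rfloor-1$ and $q=n-t$: $c=f(d^p-1)+(t-p)(d^{n-t}-d^{n-t-1})+d^{n+p-2t-1}-k$; - if $p+1\le t\le\lfloor n/2\rfloor-1$ and $q>n-t$: $c=f(d^p-1)+(t-p)(d^{n-t}-d^{n-t-1})+d^{n+p-2t-1}-d^t+d^{q-1}-d^p+\mu$; - if $t\le p$ and $q=n-t$: $c=f(d^p-1)+d^{n-p-1}-k$; - if $t\le p$ and $q>n-t$: $c=f(d^p-1)+d^{n-p-1}-d^t+d^{q-1}-d^p+\mu$. (Where two cases both apply they give the same value.) Then: (i) For every input $\mathbf a$, every $B\subseteq W_0$ with $|B|=k$, $1\le k\le\min(f,d^t)$, and all integers $p,q$ with $0\le p\le n-t-1$ and $n-t\le q\le n$, the solution $S_{p,q}$ described in the context is feasible for the linear program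 (D) in the context, with objective value equal to $c(k,p,q)$. (ii) Consequently, for the network $\log_d(N,0,m)$ to be $f$-cast wide-sense nonblocking under the window algorithm with window size $d^t$, it is sufficient that $$m\ \ge\ 1+\max_{1\le k\le\min(f,d^t)}\ \min_{\substack{0\le p\le n-t-1\\ n-t\le q\le n}} c(k,p,q).$$
   Context: Network. Let $\mathbb Z_d=\{0,\dots,d-1\}$; for a string $\mathbf s$, $\mathbf s_{i..j}=s_i\cdots s_j$. The $d$-ary inverse Banyan network $\mathrm{BY}^{-1}(n)$ has $N=d^n$ inputs and $N$ outputs, each labelled by the strings in $\mathbb Z_d^n$, and $n$ stages of $d\times d$ switching elements (SEs), the SEs of each stage being labelled by $\mathbb Z_d^{n-1}$. Input $\mathbf x$ is attached to the stage-$1$ SE $\mathbf x_{1..n-1}$ and output $\mathbf y$ to the stage-$n$ SE $\mathbf y_{1..n-1}$. For $1\le i\le n-1$, the stage-$i$ SE $\mathbf z$ is joined by one link to each of the $d$ stage-$(i+1)$ SEs whose labels agree with $\mathbf z$ in all positions except possibly position $i$. The unique route $R(\mathbf x,\mathbf y)$ passes at stage $j$ through the SE $y_1\cdots y_{j-1}x_j\cdots x_{n-1}$. The network $\log_d(N,0,m)$ consists of $m$ parallel copies (planes) of $\mathrm{BY}^{-1}(n)$; each network input is connected, through a $1\times m$ element with fanout capability, to the equally labelled input of every plane, and each network output is connected to the equally labelled output of every plane. Requests. An $f$-cast request is a pair $(\mathbf a,B)$, with $\mathbf a$ an input not involved in any existing request and $B$ a nonempty set of at most $f$ outputs, none involved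 in an existing request. Routing a (sub)request $(\mathbf a,B')$ on a plane means using on that plane the union of the routes $R(\mathbf a,\mathbf b)$, $\mathbf b\in B'$. On the same plane, routes belonging to different requests (i.e. from different inputs) may not share a link; routes from the same input may. Window algorithm with window size $d^t$. The outputs are divided into $d^{n-t}$ windows $W_0,\dots,W_{d^{n-t}-1}$ of size $d^t$, each consisting of all outputs sharing a given prefix of length $n-t$. Rule: for every request $(\mathbf a,B)$ and every $w$, the subrequest $(\mathbf a,B\cap W_w)$ is routed entirely on one single plane (different subrequests may use the same or different planes). The network is $f$-cast wide-sense nonblocking under the window algorithm if, whenever $f$-cast requests arrive and depart in arbitrary order and all existing requests have been routed following the rule, every new $f$-cast request can be routed following the rule without disturbing existing routes. Notation for (i). Fix an input $\mathbf a$ and $B=\{\mathbf b^{(1)},\dots,\mathbf b^{(k)}\}\subseteq W_0$. For $0\le i\le n-1$, $A_i$ is the set of inputs $\mathbf u\ne\mathbf a$ such that the longest common suffix of $\mathbf u_{1..n-1}$ and $\mathbf a_{1..n-1}$ has length exactly $i$; $\mathcal A=\bigcup_i A_i$, and $i(\mathbf u)$ is the index with $\mathbf u\in A_{i(\mathbf u)}$. For $0\le j\le n-1$, $B_j$ is the set of outputs $\mathbf v\notin B$ such that for some $l$ the longest common prefix of $\mathbf v_{1..n-1}$ and $\mathbf b^{(l)}_{1..n-1}$ has length exactly $j$. For $1\le w\le d^{n-t}-1$, $j(w)$ is the index $j$ with $W_w\subseteq B_j$ (one has $j(w)\le n-t-1$); for $\mathbf v\in W_0-B$, $j(\mathbf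 v)$ is the largest $j$ with $\mathbf v\in B_j$ (one has $j(\mathbf v)\ge n-t$). Linear program (D): variables $\alpha_w$ ($1\le w\le d^{n-t}-1$), $\beta_{\mathbf u,w}$ (for pairs $\mathbf u\in\mathcal A$, $w$ with $i(\mathbf u)+j(w)\ge n$), $\gamma_{\mathbf u},\epsilon_{\mathbf u}$ ($\mathbf u\in\mathcal A$), $\delta_{\mathbf v}$ ($\mathbf v\in W_0-B$), all $\ge0$; minimize $$\sum_w d^t\alpha_w+\sum_{\mathbf u,w}\beta_{\mathbf u,w}+\sum_{\mathbf u}\gamma_{\mathbf u}+\sum_{\mathbf v}\delta_{\mathbf v}+\sum_{\mathbf u}f\epsilon_{\mathbf u}$$ subject to $\alpha_w+\beta_{\mathbf u,w}+\epsilon_{\mathbf u}\ge1$ for all $\mathbf u\in\mathcal A$, $1\le w\le d^{n-t}-1$ with $i(\mathbf u)+j(w)\ge n$, and $\gamma_{\mathbf u}+\delta_{\mathbf v}+\epsilon_{\mathbf u}\ge1$ for all $\mathbf u\in\mathcal A$, $\mathbf v\in W_0-B$ with $i(\mathbf u)+j(\mathbf v)\ge n$. Solution $S_{p,q}$ (all variables not mentioned are $0$): - $\epsilon_{\mathbf u}=1$ if $i(\mathbf u)\ge n-p$. - If $t\ge\lfloor n/2\rfloor$: $\beta_{\mathbf u,w}=1$ whenever $p+1\le j(w)\le n-t-1$ and $n-j(w)\le i(\mathbf u)\le n-p-1$. If $p+1\le t\le\lfloor n/2\rfloor-1$: $\beta_{\mathbf u,w}=1$ whenever $p+1\le j(w)\le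 t$ and $n-j(w)\le i(\mathbf u)\le n-p-1$, and $\alpha_w=1$ whenever $t+1\le j(w)\le n-t-1$. If $t\le p$: $\alpha_w=1$ whenever $p+1\le j(w)\le n-t-1$. - If $q=n-t$: $\delta_{\mathbf v}=1$ for all $\mathbf v\in\bigcup_{j=n-t}^{n-1}B_j=W_0-B$. If $q\ge n-t+1$: $\delta_{\mathbf v}=1$ for all $\mathbf v\in\bigcup_{j=q}^{n-1}B_j$, and $\gamma_{\mathbf u}=1$ for all $\mathbf u$ with $n-q+1\le i(\mathbf u)\le n-p-1$.
   Formalization: In (i), equality with c(k,p,q) fails for some B when q>n-t (d=2,n=3,t=2,f=k=2,p=0,q=2,B={000,001}: objective 1, c=3); proved instead: objective ≤ c, with equality iff the union of B_j over j≥q has size μ (always if q=n-t), and some B of size k attains c. *)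

theory Defs
  imports Complex_Main "HOL-Library.Sublist"
begin

definition strings :: "nat \<Rightarrow> nat \<Rightarrow> nat list set" where
  "strings d n = {s. length s = n \<and> set s \<subseteq> {..<d}}"

text \<open>Stages are numbered from 1, whereas list positions are numbered from 0: position \<open>i\<close> of a
  label is \<open>z ! (i - 1)\<close>.\<close>

datatype node = Inp "nat list" | SE nat "nat list" | Out "nat list"

definition BY_links :: "nat \<Rightarrow> nat \<Rightarrow> (node \<times> node) set" where
  "BY_links d n =
     {(Inp x, SE 1 (take (n - 1) x)) | x. x \<in> strings d n} \<union>
     {(SE i z, SE (i + 1) z') | i z z'. 1 \<le> i \<and> i \<le> n - 1 \<and>
        z \<in> strings d (n - 1) \<and> z' \<in> strings d (n - 1) \<and>
        (\<forall>l < n - 1. l \<noteq> i - 1 \<longrightarrow> z ! l = z' ! l)} \<union>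
     {(SE n (take (n - 1) y), Out y) | y. y \<in> strings d n}"

definition route_SE :: "nat \<Rightarrow> nat list \<Rightarrow> nat list \<Rightarrow> nat \<Rightarrow> nat list" where
  "route_SE n x y j = take (j - 1) y @ drop (j - 1) (take (n - 1) x)"

definition route :: "nat \<Rightarrow> nat list \<Rightarrow> nat list \<Rightarrow> node list" where
  "route n x y = Inp x # map (\<lambda>j. SE j (route_SE n x y j)) [1..<n + 1] @ [Out y]"

definition path_links :: "node list \<Rightarrow> (node \<times> node) set" where
  "path_links ns = set (zip ns (tl ns))"

lemma path_links_subset_iff:
  "path_links P \<subseteq> L \<longleftrightarrow> (\<forall>k. k + 1 < length P \<longrightarrow> (P ! k, P ! (k + 1)) \<in> L)"
proof -
  have "path_links P = {(P ! k, P ! (k + 1)) | k. k + 1 < length P}"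
    unfolding path_links_def set_zip by (rule Collect_cong) (auto simp: nth_tl)
  then show ?thesis by (simp only: subset_iff) auto
qed

lemma route_SE_nth:
  assumes "x \<in> strings d n" "y \<in> strings d n" "1 \<le> j" "j \<le> n"
  shows "length (route_SE n x y j) = n - 1"
    and "l < n - 1 \<Longrightarrow> route_SE n x y j ! l = (if l < j - 1 then y ! l else x ! l)"
    and "route_SE n x y j \<in> strings d (n - 1)"
proof -
  have L: "length x = n" "length y = n" and S: "set x \<subseteq> {..<d}" "set y \<subseteq> {..<d}"
    using assms by (auto simp: strings_def)
  show len: "length (route_SE n x y j) = n - 1"
    using L assms(3,4) by (auto simp: route_SE_def)
  show "l < n - 1 \<Longrightarrow> route_SE n x y j ! l = (if l < j - 1 then y ! l else x ! l)"
    using L assms(3,4) by (auto simp: route_SE_def nth_append min_def)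
  have "set (route_SE n x y j) \<subseteq> set x \<union> set y"
    unfolding route_SE_def set_append
    using set_take_subset set_drop_subset by (meson Un_least le_supI1 le_supI2 order_trans)
  then show "route_SE n x y j \<in> strings d (n - 1)"
    using S len by (auto simp: strings_def)
qed

lemma route_unique:
  assumes n: "n \<ge> 1" and x: "x \<in> strings d n" and y: "y \<in> strings d n"
  shows "(P \<noteq> [] \<and> hd P = Inp x \<and> last P = Out y \<and> path_links P \<subseteq> BY_links d n)
         \<longleftrightarrow> P = route n x y"
proof
  assume P: "P = route n x y"
  have len: "length P = n + 2" by (simp add: P route_def)
  have P0: "P ! 0 = Inp x" by (simp add: P route_def)
  have Pn: "P ! (n + 1) = Out y" by (simp add: P route_def nth_append)
  have Pk: "P ! k = SE k (route_SE n x y k)" if "1 \<le> k" "k \<le> n" for k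
    using that by (cases k) (auto simp: P route_def nth_append simp del: upt_Suc)
  have L: "length x = n" "length y = n" using x y by (auto simp: strings_def)
  have "(P ! k, P ! (k + 1)) \<in> BY_links d n" if "k + 1 < length P" for k
  proof -
    have "k = 0 \<or> 1 \<le> k \<and> k < n \<or> k = n" using that len by linarith
    then consider "k = 0" | "1 \<le> k" "k < n" | "k = n" by blast
    then show ?thesis
    proof cases
      case 1
      have "P ! 1 = SE 1 (take (n - 1) x)" using Pk[of 1] n by (simp add: route_SE_def)
      then show ?thesis using 1 P0 x by (auto simp: BY_links_def)
    next
      case 2
      then have "P ! k = SE k (route_SE n x y k)" "P ! (k+1) = SE (k+1) (route_SE n x y (k+1))"
        using Pk[of k] Pk[of "k+1"] by auto
      moreover have "\<forall>l < n - 1. l \<noteq> k - 1 \<longrightarrow> route_SE n x y k ! l = route_SE n x y (k+1) ! l"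
        using 2 x y by (auto simp: route_SE_nth(2)[of _ d])
      ultimately show ?thesis
        using 2 route_SE_nth(3)[OF x y, of k] route_SE_nth(3)[OF x y, of "k+1"]
        by (auto simp: BY_links_def)
    next
      case 3
      have "P ! n = SE n (take (n - 1) y)" using Pk[of n] n L by (simp add: route_SE_def)
      then show ?thesis using 3 Pn y by (auto simp: BY_links_def)
    qed
  qed
  then have "path_links P \<subseteq> BY_links d n" by (simp add: path_links_subset_iff)
  moreover have "P \<noteq> []" "hd P = Inp x" "last P = Out y"
    by (auto simp: P route_def)
  ultimately show "P \<noteq> [] \<and> hd P = Inp x \<and> last P = Out y \<and> path_links P \<subseteq> BY_links d n"
    by blast
next
  assume A: "P \<noteq> [] \<and> hd P = Inp x \<and> last P = Out y \<and> path_links P \<subseteq> BY_links d n"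
  then have P0: "P ! 0 = Inp x" and Pl: "P ! (length P - 1) = Out y"
    and link: "\<And>k. k + 1 < length P \<Longrightarrow> (P ! k, P ! (k + 1)) \<in> BY_links d n"
    by (auto simp: hd_conv_nth last_conv_nth path_links_subset_iff)
  have L: "length x = n" "length y = n" using x y by (auto simp: strings_def)
  have len1: "length P > 1"
  proof (rule ccontr)
    assume "\<not> length P > 1"
    then have "length P = 1" using A by (cases P) auto
    then show False using P0 Pl by simp
  qed
  have stage: "k < length P \<Longrightarrow> 1 \<le> k \<Longrightarrow>
     (k \<le> n \<and> (\<exists>z. P ! k = SE k z)) \<or> (k = n + 1 \<and> (\<exists>z. P ! k = Out z))" for k
  proof (induction k)
    case (Suc k)
    show ?case
    proof (cases "k = 0")
      case True
      then show ?thesis using link[of 0] P0 Suc.prems n by (auto simp: BY_links_def)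
    next
      case False
      then show ?thesis using link[of k] Suc n by (auto simp: BY_links_def)
    qed
  qed simp
  have len: "length P = n + 2"
    using stage[of "length P - 1"] Pl len1 by auto
  define z where "z k = (THE z. P ! k = SE k z)" for k
  have z: "P ! k = SE k (z k)" if "1 \<le> k" "k \<le> n" for k
    using stage[of k] that len by (auto simp: z_def)
  have Pn: "P ! (n + 1) = Out y" using Pl len by simp
  have z1: "z 1 = take (n - 1) x"
    using link[of 0] P0 z[of 1] n len by (auto simp: BY_links_def)
  have zn: "z n = take (n - 1) y"
    using link[of n] Pn z[of n] n len by (auto simp: BY_links_def)
  have zlink: "(SE k (z k), SE (k + 1) (z (k + 1))) \<in> BY_links d n" if "1 \<le> k" "k < n" for k
    using link[of k] z[of k] z[of "k+1"] that len by simp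
  have zstr: "z k \<in> strings d (n - 1)" if "1 \<le> k" "k < n" for k
    using zlink[OF that] by (auto simp: BY_links_def)
  have same: "z k ! l = z (k + 1) ! l"
    if "1 \<le> k" "k < n" "l < n - 1" "l \<noteq> k - 1" for k l
    using zlink[OF that(1,2)] that(3,4) by (auto simp: BY_links_def)
  have zlen: "length (z k) = n - 1" if "1 \<le> k" "k \<le> n" for k
  proof (cases "k < n")
    case True then show ?thesis using zstr[of k] that by (auto simp: strings_def)
  next
    case False then show ?thesis using that zn L by auto
  qed
  have up: "k \<le> n \<Longrightarrow> (\<forall>l < n - 1. k - 1 \<le> l \<longrightarrow> z k ! l = x ! l)" if "1 \<le> k" for k
    using that
  proof (induction k rule: dec_induct)
    case base then show ?case using z1 by simp
  next
    case (step m)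
    show ?case
    proof (intro allI impI)
      fix l assume l: "l < n - 1" "Suc m - 1 \<le> l"
      have "z m ! l = z (m + 1) ! l" using same[of m l] step.hyps step.prems l by simp
      then show "z (Suc m) ! l = x ! l" using step l by simp
    qed
  qed
  have down: "1 \<le> k \<Longrightarrow> (\<forall>l < n - 1. l < k - 1 \<longrightarrow> z k ! l = y ! l)" if "k \<le> n" for k
    using that
  proof (induction k rule: inc_induct)
    case base then show ?case using zn by simp
  next
    case (step m)
    show ?case
    proof (intro allI impI)
      fix l assume l: "l < n - 1" "l < m - 1"
      have "z m ! l = z (m + 1) ! l" using same[of m l] step.hyps step.prems l by simp
      then show "z m ! l = y ! l" using step l by simp
    qed
  qed
  have zr: "z k = route_SE n x y k" if "1 \<le> k" "k \<le> n" for k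
    using that up[of k] down[of k] zlen[of k] route_SE_nth(1,2)[OF x y that]
    by (intro nth_equalityI) auto
  show "P = route n x y"
  proof (rule nth_equalityI)
    show "length P = length (route n x y)" using len by (simp add: route_def)
  next
    fix k assume "k < length P"
    then have "k = 0 \<or> 1 \<le> k \<and> k \<le> n \<or> k = n + 1" using len by linarith
    then consider "k = 0" | "1 \<le> k" "k \<le> n" | "k = n + 1" by blast
    then show "P ! k = route n x y ! k"
    proof cases
      case 2
      then show ?thesis using z[of k] zr[of k]
        by (cases k) (auto simp: route_def nth_append simp del: upt_Suc)
    qed (use P0 Pn in \<open>auto simp: route_def nth_append\<close>)
  qed
qed

definition windows :: "nat \<Rightarrow> nat \<Rightarrow> nat \<Rightarrow> nat list set set" where
  "windows d n t = {{y \<in> strings d n. take (n - t) y = s} | s. s \<in> strings d (n - t)}"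

text \<open>A connection is a request together with its routing: \<open>plane c b\<close> is the plane on which the
  output \<open>b\<close> is reached; it is meaningful only for \<open>b \<in> dests c\<close>.\<close>

datatype connection =
  Connection (src: "nat list") (dests: "nat list set") (plane: "nat list \<Rightarrow> nat")

text \<open>Links of the multi-plane network, tagged with their plane. The links between the network
  inputs and outputs and the planes need not be recorded: each of them is used only by requests
  involving the network input or output in question.\<close>

definition conn_links :: "nat \<Rightarrow> connection \<Rightarrow> (nat \<times> node \<times> node) set" where
  "conn_links n c = (\<Union>b \<in> dests c. {plane c b} \<times> path_links (route n (src c) b))"

definition window_rule :: "nat \<Rightarrow> nat \<Rightarrow> nat \<Rightarrow> connection \<Rightarrow> bool" where
  "window_rule d n t c \<longleftrightarrow>
     (\<forall>V \<in> windows d n t. \<exists>r. \<forall>b \<in> dests c \<inter> V. plane c b = r)"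

definition new_request ::
  "nat \<Rightarrow> nat \<Rightarrow> nat \<Rightarrow> connection set \<Rightarrow> nat list \<Rightarrow> nat list set \<Rightarrow> bool" where
  "new_request d n f S a B \<longleftrightarrow>
     a \<in> strings d n \<and> B \<subseteq> strings d n \<and> B \<noteq> {} \<and> card B \<le> f \<and>
     (\<forall>c \<in> S. src c \<noteq> a \<and> dests c \<inter> B = {})"

definition routable :: "nat \<Rightarrow> nat \<Rightarrow> nat \<Rightarrow> nat \<Rightarrow> connection set \<Rightarrow> connection \<Rightarrow> bool" where
  "routable d n t m S c \<longleftrightarrow>
     (\<forall>b \<in> dests c. plane c b < m) \<and> window_rule d n t c \<and>
     (\<forall>c' \<in> S. conn_links n c \<inter> conn_links n c' = {})"

inductive reachable :: "nat \<Rightarrow> nat \<Rightarrow> nat \<Rightarrow> nat \<Rightarrow> nat \<Rightarrow> connection set \<Rightarrow> bool"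
  for d n t f m where
  idle: "reachable d n t f m {}"
| arrival: "\<lbrakk>reachable d n t f m S; new_request d n f S (src c) (dests c);
             routable d n t m S c\<rbrakk> \<Longrightarrow> reachable d n t f m (insert c S)"
| departure: "\<lbrakk>reachable d n t f m S; c \<in> S\<rbrakk> \<Longrightarrow> reachable d n t f m (S - {c})"

definition wsnb_window :: "nat \<Rightarrow> nat \<Rightarrow> nat \<Rightarrow> nat \<Rightarrow> nat \<Rightarrow> bool" where
  "wsnb_window d n t f m \<longleftrightarrow>
     (\<forall>S a B. reachable d n t f m S \<longrightarrow> new_request d n f S a B \<longrightarrow>
        (\<exists>c. src c = a \<and> dests c = B \<and> routable d n t m S c))"

text \<open>Throughout, \<open>W\<close> enumerates the windows, \<open>a\<close> is the source and \<open>B\<close> the set of destinations of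
  the new subrequest, with \<open>B \<subseteq> W 0\<close>.\<close>

definition lcp_len :: "nat list \<Rightarrow> nat list \<Rightarrow> nat" where
  "lcp_len xs ys = length (longest_common_prefix xs ys)"

definition lcs_len :: "nat list \<Rightarrow> nat list \<Rightarrow> nat" where
  "lcs_len xs ys = lcp_len (rev xs) (rev ys)"

definition Aset :: "nat \<Rightarrow> nat \<Rightarrow> nat list \<Rightarrow> nat \<Rightarrow> nat list set" where
  "Aset d n a i =
     {u \<in> strings d n. u \<noteq> a \<and> lcs_len (take (n - 1) u) (take (n - 1) a) = i}"

definition Aall :: "nat \<Rightarrow> nat \<Rightarrow> nat list \<Rightarrow> nat list set" where
  "Aall d n a = (\<Union>i \<in> {0..n - 1}. Aset d n a i)"

definition i_of :: "nat \<Rightarrow> nat \<Rightarrow> nat list \<Rightarrow> nat list \<Rightarrow> nat" where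
  "i_of d n a u = (THE i. i \<le> n - 1 \<and> u \<in> Aset d n a i)"

definition Bset :: "nat \<Rightarrow> nat \<Rightarrow> nat list set \<Rightarrow> nat \<Rightarrow> nat list set" where
  "Bset d n B j =
     {v \<in> strings d n - B. \<exists>b \<in> B. lcp_len (take (n - 1) v) (take (n - 1) b) = j}"

definition j_win :: "nat \<Rightarrow> nat \<Rightarrow> nat list set \<Rightarrow> nat list set \<Rightarrow> nat" where
  "j_win d n B V = (THE j. j \<le> n - 1 \<and> V \<subseteq> Bset d n B j)"

definition j_out :: "nat \<Rightarrow> nat \<Rightarrow> nat list set \<Rightarrow> nat list \<Rightarrow> nat" where
  "j_out d n B v = Max {j. j \<le> n - 1 \<and> v \<in> Bset d n B j}"

text \<open>Components outside the index sets below are irrelevant.\<close>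

record dual_vars =
  alpha :: "nat \<Rightarrow> real"
  beta :: "nat list \<Rightarrow> nat \<Rightarrow> real"
  gamma :: "nat list \<Rightarrow> real"
  delta :: "nat list \<Rightarrow> real"
  epsilon :: "nat list \<Rightarrow> real"

definition win_idx :: "nat \<Rightarrow> nat \<Rightarrow> nat \<Rightarrow> nat set" where
  "win_idx d n t = {1..d ^ (n - t) - 1}"

definition beta_idx ::
  "nat \<Rightarrow> nat \<Rightarrow> nat \<Rightarrow> (nat \<Rightarrow> nat list set) \<Rightarrow> nat list \<Rightarrow> nat list set \<Rightarrow> (nat list \<times> nat) set" where
  "beta_idx d n t W a B =
     {(u, w). u \<in> Aall d n a \<and> w \<in> win_idx d n t \<and> i_of d n a u + j_win d n B (W w) \<ge> n}"

definition dual_objective ::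
  "nat \<Rightarrow> nat \<Rightarrow> nat \<Rightarrow> nat \<Rightarrow> (nat \<Rightarrow> nat list set) \<Rightarrow> nat list \<Rightarrow> nat list set \<Rightarrow> dual_vars \<Rightarrow> real"
  where
  "dual_objective d n t f W a B s =
     (\<Sum>w \<in> win_idx d n t. real (d ^ t) * alpha s w)
     + (\<Sum>(u, w) \<in> beta_idx d n t W a B. beta s u w)
     + (\<Sum>u \<in> Aall d n a. gamma s u)
     + (\<Sum>v \<in> W 0 - B. delta s v)
     + (\<Sum>u \<in> Aall d n a. real f * epsilon s u)"

definition dual_feasible ::
  "nat \<Rightarrow> nat \<Rightarrow> nat \<Rightarrow> (nat \<Rightarrow> nat list set) \<Rightarrow> nat list \<Rightarrow> nat list set \<Rightarrow> dual_vars \<Rightarrow> bool" where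
  "dual_feasible d n t W a B s \<longleftrightarrow>
     (\<forall>w \<in> win_idx d n t. alpha s w \<ge> 0) \<and>
     (\<forall>(u, w) \<in> beta_idx d n t W a B. beta s u w \<ge> 0) \<and>
     (\<forall>u \<in> Aall d n a. gamma s u \<ge> 0) \<and>
     (\<forall>v \<in> W 0 - B. delta s v \<ge> 0) \<and>
     (\<forall>u \<in> Aall d n a. epsilon s u \<ge> 0) \<and>
     (\<forall>u \<in> Aall d n a. \<forall>w \<in> win_idx d n t. i_of d n a u + j_win d n B (W w) \<ge> n \<longrightarrow>
        alpha s w + beta s u w + epsilon s u \<ge> 1) \<and>
     (\<forall>u \<in> Aall d n a. \<forall>v \<in> W 0 - B. i_of d n a u + j_out d n B v \<ge> n \<longrightarrow>
        gamma s u + delta s v + epsilon s u \<ge> 1)"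

definition dual_solution ::
  "nat \<Rightarrow> nat \<Rightarrow> nat \<Rightarrow> (nat \<Rightarrow> nat list set) \<Rightarrow> nat list \<Rightarrow> nat list set \<Rightarrow> nat \<Rightarrow> nat \<Rightarrow> dual_vars"
  where
  "dual_solution d n t W a B p q =
     \<lparr> alpha = (\<lambda>w. let j = j_win d n B (W w) in
         if n div 2 \<le> t then 0
         else if p + 1 \<le> t then of_bool (t + 1 \<le> j \<and> j \<le> n - t - 1)
         else of_bool (p + 1 \<le> j \<and> j \<le> n - t - 1)),
       beta = (\<lambda>u w. let i = i_of d n a u; j = j_win d n B (W w) in
         if n div 2 \<le> t
           then of_bool (p + 1 \<le> j \<and> j \<le> n - t - 1 \<and> n - j \<le> i \<and> i \<le> n - p - 1)
         else if p + 1 \<le> t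
           then of_bool (p + 1 \<le> j \<and> j \<le> t \<and> n - j \<le> i \<and> i \<le> n - p - 1)
         else 0),
       gamma = (\<lambda>u. of_bool (q \<ge> n - t + 1 \<and>
         n - q + 1 \<le> i_of d n a u \<and> i_of d n a u \<le> n - p - 1)),
       delta = (\<lambda>v. of_bool (v \<in> (\<Union>j \<in> {q..n - 1}. Bset d n B j))),
       epsilon = (\<lambda>u. of_bool (i_of d n a u \<ge> n - p)) \<rparr>"

text \<open>For \<open>B \<subseteq> W 0\<close> with \<open>card B = k\<close>, \<open>mu d n t k q\<close> is the largest possible number of outputs
  in \<open>\<Union>j \<in> {q..n - 1}. Bset d n B j\<close>, i.e. of outputs outside \<open>B\<close> sharing the first \<open>q\<close> digits
  with an element of \<open>B\<close>. For \<open>n - t < q < n\<close> the number is smaller if elements of \<open>B\<close> share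
  these digits while not all \<open>q\<close>-digit prefixes occurring in \<open>W 0\<close> are met by \<open>B\<close>.\<close>

definition mu :: "nat \<Rightarrow> nat \<Rightarrow> nat \<Rightarrow> nat \<Rightarrow> nat \<Rightarrow> int" where
  "mu d n t k q = min (int d ^ t - int k) (int k * (int d ^ (n - q) - 1))"

text \<open>Where the conditions \<open>n div 2 \<le> t\<close> and \<open>t \<le> p\<close> overlap (then \<open>t = p = n - t - 1\<close>), both
  branches have the same value.\<close>

definition c_bound :: "nat \<Rightarrow> nat \<Rightarrow> nat \<Rightarrow> nat \<Rightarrow> nat \<Rightarrow> nat \<Rightarrow> nat \<Rightarrow> int" where
  "c_bound d n t f k p q = (let D = int d in
     if n div 2 \<le> t then
       (if q = n - t
        then int f * (D ^ p - 1) + int (n - t - 1 - p) * (D ^ (n - t) - D ^ (n - t - 1))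
             - D ^ (n - t - 1) + D ^ p + D ^ t - int k
        else int f * (D ^ p - 1) + int (n - t - 1 - p) * (D ^ (n - t) - D ^ (n - t - 1))
             - D ^ (n - t - 1) + D ^ (q - 1) + mu d n t k q)
     else if p + 1 \<le> t then
       (if q = n - t
        then int f * (D ^ p - 1) + int (t - p) * (D ^ (n - t) - D ^ (n - t - 1))
             + D ^ (n + p - 2 * t - 1) - int k
        else int f * (D ^ p - 1) + int (t - p) * (D ^ (n - t) - D ^ (n - t - 1))
             + D ^ (n + p - 2 * t - 1) - D ^ t + D ^ (q - 1) - D ^ p + mu d n t k q)
     else
       (if q = n - t
        then int f * (D ^ p - 1) + D ^ (n - p - 1) - int k
        else int f * (D ^ p - 1) + D ^ (n - p - 1) - D ^ t + D ^ (q - 1) - D ^ p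
             + mu d n t k q))"

end

theory Submission
  imports Defs "HOL-Combinatorics.Transposition"
begin

text \<open>A plane blocked for the new subrequest \<open>(a, B)\<close> carries a route from some \<open>u\<close> to some \<open>v\<close> that
  shares a link with a route from \<open>a\<close> into \<open>B\<close>; this forces the common suffix of the inputs and the
  common prefix of the outputs to have total length at least \<open>n\<close>, so the pair selects one constraint
  of the dual program. Choose one such pair for each blocked plane and add up the selected constraints
  of a dual feasible solution. Distinct planes have distinct \<open>v\<close>, by the window rule \<open>u\<close> uses only one
  plane per window, and \<open>u\<close> has at most \<open>f\<close> outputs; hence every dual variable is counted at most as
  often as its objective coefficient says, and the number of blocked planes is at most the objective
  value. Windows can be treated separately since routes from the same input never conflict.

  The objective value of \<open>S\<^sub>p\<^sub>,\<^sub>q\<close> follows from level counts: \<open>d ^ (n - i) - 1\<close> inputs have index at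
  least \<open>i\<close>, and \<open>d ^ (n - t - j) - 1\<close> windows have index at least \<open>j\<close>. Its only term depending on the
  choice of \<open>B\<close> is the number of outputs outside \<open>B\<close> sharing \<open>q\<close> digits with \<open>B\<close>, which equals
  \<open>d ^ (n - q)\<close> times the number of \<open>q\<close>-digit prefixes met by \<open>B\<close>, minus the size of \<open>B\<close>.\<close>

section \<open>Strings\<close>

lemma finite_strings: "finite (strings d n)"
  unfolding strings_def using finite_lists_length_eq[of "{..<d}" n]
  by (simp add: conj_commute)

lemma card_strings: "card (strings d n) = d ^ n"
  unfolding strings_def using card_lists_length_eq[of "{..<d}" n]
  by (simp add: conj_commute)

lemma length_string: "x \<in> strings d n \<Longrightarrow> length x = n"
  by (simp add: strings_def)

lemma append_in_strings:
  "x \<in> strings d k \<Longrightarrow> y \<in> strings d l \<Longrightarrow> x @ y \<in> strings d (k + l)"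
  by (auto simp: strings_def)

lemma take_in_strings: "x \<in> strings d n \<Longrightarrow> k \<le> n \<Longrightarrow> take k x \<in> strings d k"
  using set_take_subset[of k x] by (auto simp: strings_def)

lemma drop_in_strings: "x \<in> strings d n \<Longrightarrow> drop k x \<in> strings d (n - k)"
  using set_drop_subset[of k x] by (auto simp: strings_def)

text \<open>The digits outside the block are free. Prefixes of outputs are blocks starting at 0; a
  common suffix of \<open>take (n - 1) u\<close> and \<open>take (n - 1) a\<close> is a block
  followed by one free digit, the last.\<close>

lemma card_strings_block:
  assumes kl: "k + l \<le> n" and c: "c \<in> strings d l"
  shows "card {u \<in> strings d n. take l (drop k u) = c} = d ^ (n - l)"
proof -
  let ?g = "\<lambda>(x, z). x @ c @ z"
  have "bij_betw ?g (strings d k \<times> strings d (n - k - l)) {u \<in> strings d n. take l (drop k u) = c}"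
    unfolding bij_betw_def
  proof (intro conjI)
    show "inj_on ?g (strings d k \<times> strings d (n - k - l))"
    proof (rule inj_onI, clarify)
      fix x z x' z'
      assume "x \<in> strings d k" "x' \<in> strings d k" and eq: "x @ c @ z = x' @ c @ z'"
      then have "length x = length x'" by (simp add: length_string)
      then show "x = x' \<and> z = z'" using eq by simp
    qed
    show "?g ` (strings d k \<times> strings d (n - k - l)) = {u \<in> strings d n. take l (drop k u) = c}"
    proof (intro equalityI subsetI)
      fix u assume "u \<in> ?g ` (strings d k \<times> strings d (n - k - l))"
      then obtain x z where xz: "x \<in> strings d k" "z \<in> strings d (n - k - l)" "u = x @ c @ z"
        by auto
      have "u \<in> strings d (k + (l + (n - k - l)))"
        unfolding xz(3) by (intro append_in_strings xz c)
      then show "u \<in> {u \<in> strings d n. take l (drop k u) = c}"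
        using kl xz(3) length_string[OF xz(1)] length_string[OF c] by simp
    next
      fix u assume u: "u \<in> {u \<in> strings d n. take l (drop k u) = c}"
      then have "c @ drop (k + l) u = drop k u"
        using append_take_drop_id[of l "drop k u"] by (simp add: add.commute)
      then have "u = take k u @ c @ drop (k + l) u" by simp
      moreover have "take k u \<in> strings d k" "drop (k + l) u \<in> strings d (n - k - l)"
        using u kl take_in_strings[of u d n k] drop_in_strings[of u d n "k + l"] by auto
      ultimately show "u \<in> ?g ` (strings d k \<times> strings d (n - k - l))"
        by (intro image_eqI[of _ _ "(take k u, drop (k + l) u)"]) auto
    qed
  qed
  then have "card {u \<in> strings d n. take l (drop k u) = c} = d ^ k * d ^ (n - k - l)"
    by (simp add: bij_betw_same_card[symmetric] card_cartesian_product card_strings)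
  then show ?thesis using kl by (simp add: power_add[symmetric])
qed

lemma card_strings_prefix:
  assumes "j \<le> n" "c \<in> strings d j"
  shows "card {u \<in> strings d n. take j u = c} = d ^ (n - j)"
  using card_strings_block[of 0 j n c d] assms by simp

section \<open>Common prefix and suffix lengths\<close>

lemma take_eq_mono: "take k xs = take k ys \<Longrightarrow> j \<le> k \<Longrightarrow> take j xs = take j ys"
  by (metis min.absorb1 take_take)

text \<open>Thresholds turn common prefix lengths into equalities of \<open>take j\<close>, which
  can be counted; exact levels are recovered later as differences of thresholds.\<close>

lemma lcp_len_ge_iff:
  "j \<le> lcp_len xs ys \<longleftrightarrow> j \<le> length xs \<and> j \<le> length ys \<and> take j xs = take j ys"
proof
  assume j: "j \<le> lcp_len xs ys"
  let ?p = "longest_common_prefix xs ys"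
  obtain r where r: "xs = ?p @ r" using longest_common_prefix_prefix1 prefixE by blast
  obtain s where s: "ys = ?p @ s" using longest_common_prefix_prefix2 prefixE by blast
  have "take j xs = take j ?p" "take j ys = take j ?p"
    using j r s unfolding lcp_len_def
    by (metis append_Nil2 diff_is_0_eq take_0 take_append)+
  moreover have "length ?p \<le> length xs" "length ?p \<le> length ys"
    using prefix_length_le[OF longest_common_prefix_prefix1]
      prefix_length_le[OF longest_common_prefix_prefix2] by blast+
  ultimately show "j \<le> length xs \<and> j \<le> length ys \<and> take j xs = take j ys"
    using j by (auto simp: lcp_len_def)
next
  assume j: "j \<le> length xs \<and> j \<le> length ys \<and> take j xs = take j ys"
  have "prefix (take j xs) (longest_common_prefix xs ys)"
    using j take_is_prefix[of j xs] take_is_prefix[of j ys]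
    by (intro longest_common_prefix_max_prefix) auto
  then have "length (take j xs) \<le> lcp_len xs ys"
    unfolding lcp_len_def by (rule prefix_length_le)
  then show "j \<le> lcp_len xs ys" using j by simp
qed

lemma lcp_len_take_ge_iff:
  assumes "v \<in> strings d n" "b \<in> strings d n"
  shows "j \<le> lcp_len (take (n - 1) v) (take (n - 1) b) \<longleftrightarrow> j \<le> n - 1 \<and> take j v = take j b"
  using assms by (auto simp: lcp_len_ge_iff min_def dest: length_string)

text \<open>Reversal turns the last \<open>i\<close> digits of \<open>take (n - 1) u\<close> into a
  prefix; in \<open>u\<close> they begin at position \<open>n - 1 - i\<close>.\<close>

lemma lcs_len_take_ge_iff:
  assumes "u \<in> strings d n" "a \<in> strings d n"
  shows "i \<le> lcs_len (take (n - 1) u) (take (n - 1) a) \<longleftrightarrow>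
    i \<le> n - 1 \<and> take i (drop (n - 1 - i) u) = take i (drop (n - 1 - i) a)"
proof -
  have "take i (rev (take (n - 1) x)) = rev (take i (drop (n - 1 - i) x))"
    if "i \<le> n - 1" "x \<in> strings d n" for x
  proof -
    have "length (take (n - 1) x) = n - 1" using that by (simp add: length_string)
    then have "take i (rev (take (n - 1) x)) = rev (drop (n - 1 - i) (take (n - 1) x))"
      by (simp only: take_rev)
    moreover have "n - 1 - (n - 1 - i) = i" using that by simp
    ultimately show ?thesis by (simp only: drop_take)
  qed
  then show ?thesis
    using assms by (auto simp: lcs_len_def lcp_len_ge_iff dest: length_string)
qed

lemma lcp_len_take_le:
  "lcp_len (take (n - 1) v) (take (n - 1) b) \<le> n - 1"
  using lcp_len_ge_iff[of "lcp_len (take (n - 1) v) (take (n - 1) b)" "take (n - 1) v"] by force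

lemma lcs_len_take_le:
  "lcs_len (take (n - 1) u) (take (n - 1) a) \<le> n - 1"
  unfolding lcs_len_def
  using lcp_len_ge_iff[of "lcp_len (rev (take (n - 1) u)) (rev (take (n - 1) a))"
      "rev (take (n - 1) u)"] by force

section \<open>Link sharing\<close>

lemma path_links_conv_nth: "path_links P = {(P ! k, P ! (k + 1)) | k. k + 1 < length P}"
  unfolding path_links_def set_zip by (rule Collect_cong) (auto simp: nth_tl)

lemma length_route: "length (route n x y) = n + 2"
  by (simp add: route_def)

lemma route_nth:
  "k \<le> n + 1 \<Longrightarrow> route n x y ! k =
     (if k = 0 then Inp x else if k \<le> n then SE k (route_SE n x y k) else Out y)"
  by (cases k) (auto simp: route_def nth_append simp del: upt_Suc)

text \<open>The first link of a route determines its input and the last one its output, so a shared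
  link joins stages \<open>k\<close> and \<open>k + 1\<close> with \<open>1 <= k < n\<close>. Equal
  SEs at stage \<open>k\<close> make the inputs agree on the last \<open>n - k\<close> of their
  first \<open>n - 1\<close> digits; equal SEs at stage \<open>k + 1\<close> make the outputs agree
  on the first \<open>k\<close>. Together these are \<open>n\<close> digits.\<close>

lemma shared_link_imp:
  assumes a: "a \<in> strings d n" and u: "u \<in> strings d n"
    and b: "b \<in> strings d n" and v: "v \<in> strings d n"
    and "u \<noteq> a" "v \<noteq> b"
    and meet: "path_links (route n a b) \<inter> path_links (route n u v) \<noteq> {}"
  shows "n \<le> lcs_len (take (n - 1) u) (take (n - 1) a)
           + lcp_len (take (n - 1) v) (take (n - 1) b)"
proof -
  obtain k l where k: "k \<le> n" and l: "l \<le> n"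
    and e1: "route n a b ! k = route n u v ! l"
    and e2: "route n a b ! (k + 1) = route n u v ! (l + 1)"
  proof -
    from meet obtain e where "e \<in> path_links (route n a b)" "e \<in> path_links (route n u v)"
      by blast
    then obtain k l where "k + 1 < n + 2" "l + 1 < n + 2"
      "e = (route n a b ! k, route n a b ! (k + 1))" "e = (route n u v ! l, route n u v ! (l + 1))"
      unfolding path_links_conv_nth length_route by blast
    then show thesis by (intro that[of k l]) auto
  qed
  have kl: "l = k" and k1: "1 \<le> k" "k < n"
    using e1 e2 k l \<open>u \<noteq> a\<close> \<open>v \<noteq> b\<close> by (auto simp: route_nth split: if_splits)
  have s1: "route_SE n a b k = route_SE n u v k"
    and s2: "route_SE n a b (k + 1) = route_SE n u v (k + 1)"
    using e1 e2 kl k1 by (auto simp: route_nth)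
  have len: "length a = n" "length u = n" "length b = n" "length v = n"
    using a u b v by (auto dest: length_string)
  have "drop (k - 1) (take (n - 1) a) = drop (k - 1) (take (n - 1) u)"
    using s1 len k1 by (auto simp: route_SE_def)
  then have "take (n - k) (drop (n - 1 - (n - k)) u) = take (n - k) (drop (n - 1 - (n - k)) a)"
    using k1 by (simp add: drop_take)
  then have "n - k \<le> lcs_len (take (n - 1) u) (take (n - 1) a)"
    using k1 unfolding lcs_len_take_ge_iff[OF u a] by simp
  moreover have "take k v = take k b"
    using s2 len k1 by (auto simp: route_SE_def)
  then have "k \<le> lcp_len (take (n - 1) v) (take (n - 1) b)"
    using k1 unfolding lcp_len_take_ge_iff[OF v b] by simp
  ultimately show ?thesis using k1 by linarith
qed

section \<open>Level counts\<close>

text \<open>The interval is the difference of two thresholds; \<open>l <= h + 1\<close> also admits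
  the empty interval, with value 0.\<close>

lemma sum_of_bool_interval:
  fixes g :: "'a \<Rightarrow> nat"
  assumes "finite X" "l \<le> h + 1"
  shows "(\<Sum>x\<in>X. of_bool (l \<le> g x \<and> g x \<le> h)) =
     real (card {x \<in> X. l \<le> g x}) - real (card {x \<in> X. h + 1 \<le> g x})"
proof -
  have "{x \<in> X. l \<le> g x} = {x \<in> X. l \<le> g x \<and> g x \<le> h} \<union> {x \<in> X. h + 1 \<le> g x}"
    using assms by auto
  moreover have "card ({x \<in> X. l \<le> g x \<and> g x \<le> h} \<union> {x \<in> X. h + 1 \<le> g x}) =
      card {x \<in> X. l \<le> g x \<and> g x \<le> h} + card {x \<in> X. h + 1 \<le> g x}"
    using assms by (intro card_Un_disjoint) auto
  moreover have "(\<Sum>x\<in>X. of_bool (l \<le> g x \<and> g x \<le> h)) = real (card {x \<in> X. l \<le> g x \<and> g x \<le> h})"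
    using assms by (simp add: Int_def)
  ultimately show ?thesis by simp
qed

lemma i_of_eq:
  assumes "u \<in> strings d n" "u \<noteq> a"
  shows "i_of d n a u = lcs_len (take (n - 1) u) (take (n - 1) a)"
  unfolding i_of_def using assms lcs_len_take_le
  by (intro the_equality) (auto simp: Aset_def)

lemma Aall_eq: "Aall d n a = strings d n - {a}"
  using lcs_len_take_le by (auto simp: Aall_def Aset_def)

lemma finite_Aall: "finite (Aall d n a)"
  by (simp add: Aall_eq finite_strings)

text \<open>For \<open>i < n\<close> these inputs share with \<open>a\<close> the block of
  \<open>i\<close> digits just before the last digit, and \<open>a\<close> itself is removed. No
  index reaches \<open>n\<close>, since only \<open>n - 1\<close> digits are compared, which fits
  \<open>d ^ 0 - 1 = 0\<close>.\<close>

lemma card_i_of_ge: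
  assumes a: "a \<in> strings d n" and i: "i \<le> n" and n: "1 \<le> n"
  shows "card {u \<in> Aall d n a. i \<le> i_of d n a u} = d ^ (n - i) - 1"
proof (cases "i = n")
  case True
  have "\<not> n \<le> i_of d n a u" if "u \<in> Aall d n a" for u
    using that i_of_eq[of u d n a] lcs_len_take_le[of n u a] n by (auto simp: Aall_eq)
  then have empty: "{u \<in> Aall d n a. i \<le> i_of d n a u} = {}" using True by blast
  show ?thesis unfolding empty using True by simp
next
  case False
  let ?c = "take i (drop (n - 1 - i) a)"
  let ?X = "{u \<in> strings d n. take i (drop (n - 1 - i) u) = ?c}"
  have "?c \<in> strings d i"
    using False i by (intro take_in_strings[OF drop_in_strings[OF a]]) auto
  then have "card ?X = d ^ (n - i)" using False i by (intro card_strings_block) auto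
  moreover have "{u \<in> Aall d n a. i \<le> i_of d n a u} = ?X - {a}"
  proof -
    have "i \<le> i_of d n a u \<longleftrightarrow> take i (drop (n - 1 - i) u) = ?c" if "u \<in> strings d n" "u \<noteq> a" for u
      using False i unfolding i_of_eq[OF that] lcs_len_take_ge_iff[OF that(1) a] by auto
    then show ?thesis by (auto simp: Aall_eq)
  qed
  ultimately show ?thesis using a by simp
qed

lemma sum_i_of_interval:
  assumes "0 < d" "a \<in> strings d n" "x \<le> y" "y \<le> n" "x < n"
  shows "(\<Sum>u\<in>Aall d n a. of_bool (n - y \<le> i_of d n a u \<and> i_of d n a u \<le> n - x - 1))
     = real d ^ y - real d ^ x"
proof -
  have "d ^ k \<ge> 1" for k using assms(1) by simp
  then have "real (d ^ k - 1) = real d ^ k - 1" for k by (simp add: of_nat_diff)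
  moreover have "n - x - 1 + 1 = n - x" "n - (n - y) = y" "n - (n - x) = x"
    using assms by auto
  ultimately show ?thesis
    using sum_of_bool_interval[OF finite_Aall, of "n - y" "n - x - 1" "i_of d n a" d n a] assms
    by (simp add: card_i_of_ge)
qed

lemma sum_i_of_ge:
  assumes "0 < d" "a \<in> strings d n" "p < n"
  shows "(\<Sum>u\<in>Aall d n a. of_bool (n - p \<le> i_of d n a u)) = real d ^ p - 1"
proof -
  have "d ^ p \<ge> 1" using assms(1) by simp
  then show ?thesis
    using assms card_i_of_ge[of a d n "n - p"] by (simp add: finite_Aall Int_def of_nat_diff)
qed

section \<open>Outputs sharing \<open>q\<close> digits with \<open>B\<close>\<close>

lemma Union_Bset_eq:
  assumes "B \<subseteq> strings d n" "q \<le> n" "1 \<le> n"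
  shows "(\<Union>j \<in> {q..n - 1}. Bset d n B j) = {v \<in> strings d n - B. \<exists>b\<in>B. take q v = take q b}"
proof (intro equalityI subsetI)
  fix v assume "v \<in> (\<Union>j \<in> {q..n - 1}. Bset d n B j)"
  then obtain b where b: "v \<in> strings d n - B" "b \<in> B"
    "q \<le> lcp_len (take (n - 1) v) (take (n - 1) b)"
    by (auto simp: Bset_def)
  then have "take q v = take q b" using assms lcp_len_take_ge_iff[of v d n b q] by blast
  then show "v \<in> {v \<in> strings d n - B. \<exists>b\<in>B. take q v = take q b}" using b by blast
next
  fix v assume "v \<in> {v \<in> strings d n - B. \<exists>b\<in>B. take q v = take q b}"
  then obtain b where b: "v \<in> strings d n" "v \<notin> B" "b \<in> B" "take q v = take q b" by blast
  have bs: "b \<in> strings d n" using b assms by blast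
  \<comment> \<open>Only \<open>n - 1\<close> digits enter \<open>lcp_len\<close>, so
    \<open>q = n\<close> must be ruled out: agreement in all \<open>n\<close> digits would put
    \<open>v\<close> into \<open>B\<close>.\<close>
  have "q \<noteq> n"
  proof
    assume "q = n"
    then have "v = b" using b bs by (simp add: length_string)
    then show False using b by blast
  qed
  then have "q \<le> lcp_len (take (n - 1) v) (take (n - 1) b)"
    using assms b lcp_len_take_ge_iff[OF b(1) bs, of q] by simp
  then show "v \<in> (\<Union>j \<in> {q..n - 1}. Bset d n B j)"
    using b lcp_len_take_le[of n v b] by (auto simp: Bset_def)
qed

text \<open>Together with \<open>B\<close> these outputs fill the classes of equal
  \<open>q\<close>-digit prefix that meet \<open>B\<close>, each of size
  \<open>d ^ (n - q)\<close>.\<close>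

lemma card_Union_Bset:
  assumes B: "B \<subseteq> strings d n" and q: "q \<le> n" "1 \<le> n"
  shows "card (\<Union>j \<in> {q..n - 1}. Bset d n B j) + card B = card (take q ` B) * d ^ (n - q)"
proof -
  let ?U = "{v \<in> strings d n - B. \<exists>b\<in>B. take q v = take q b}"
  let ?F = "\<lambda>s. {v \<in> strings d n. take q v = s}"
  have finB: "finite B" using B finite_strings finite_subset by blast
  have "card (?U \<union> B) = card ?U + card B"
    using finB finite_strings by (intro card_Un_disjoint) auto
  moreover have "?U \<union> B = (\<Union>s\<in>take q ` B. ?F s)" using B by auto
  moreover have "card (\<Union>s\<in>take q ` B. ?F s) = (\<Sum>s\<in>take q ` B. card (?F s))"
    using finB finite_strings by (intro card_UN_disjoint) auto
  moreover have "(\<Sum>s\<in>take q ` B. card (?F s)) = (\<Sum>s\<in>take q ` B. d ^ (n - q))"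
    using B q by (intro sum.cong refl card_strings_prefix) (auto intro: take_in_strings)
  ultimately show ?thesis unfolding Union_Bset_eq[OF assms] by simp
qed

text \<open>This supplies a \<open>B\<close> with as many distinct prefixes as its size allows. A
  transversal \<open>T\<close> of the fibres of \<open>g\<close> on \<open>X\<close> is cut down or
  enlarged to \<open>k\<close> elements.\<close>

lemma ex_subset_card_image:
  assumes "finite X" "k \<le> card X"
  shows "\<exists>B\<subseteq>X. card B = k \<and> card (g ` B) = min k (card (g ` X))"
proof -
  obtain T where T: "T \<subseteq> X" "inj_on g T" "g ` X = g ` T"
    using subset_image_inj[of "g ` X" g X] by auto
  have cT: "card T = card (g ` X)" using T card_image by metis
  show ?thesis
  proof (cases "k \<le> card T")
    case True
    then obtain B where "B \<subseteq> T" "card B = k" using obtain_subset_with_card_n by metis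
    then show ?thesis using T cT True card_image[of g B] inj_on_subset[of g T B]
      by (intro exI[of _ B]) auto
  next
    case False
    then obtain B where B: "T \<subseteq> B" "B \<subseteq> X" "card B = k"
      using exists_subset_between[of T k X] T assms by auto
    then have "g ` B = g ` X" using T by blast
    then show ?thesis using B cT False by (intro exI[of _ B]) auto
  qed
qed

section \<open>Numbered windows\<close>

definition window :: "nat \<Rightarrow> nat \<Rightarrow> nat \<Rightarrow> nat list \<Rightarrow> nat list set" where
  "window d n t s = {y \<in> strings d n. take (n - t) y = s}"

lemma windows_eq: "windows d n t = window d n t ` strings d (n - t)"
  by (auto simp: windows_def window_def)

lemma card_window:
  assumes "t \<le> n" "s \<in> strings d (n - t)"
  shows "card (window d n t s) = d ^ t"
  using card_strings_prefix[of "n - t" n s d] assms by (simp add: window_def)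

lemma inj_on_window:
  assumes "0 < d" "t \<le> n"
  shows "inj_on (window d n t) (strings d (n - t))"
proof (rule inj_onI)
  fix s s' assume s: "s \<in> strings d (n - t)" "window d n t s = window d n t s'"
  have "card (window d n t s) \<noteq> 0" using card_window[OF assms(2) s(1)] assms by simp
  then obtain y where "y \<in> window d n t s" by fastforce
  then show "s = s'" using s(2) by (auto simp: window_def)
qed

text \<open>The numbering is a parameter since every window met by a request has to play the role of
  \<open>W 0\<close> in turn.\<close>

locale window_numbering =
  fixes d n t :: nat and W :: "nat \<Rightarrow> nat list set"
  assumes d_pos: "0 < d" and t_less: "t < n"
    and bij_W: "bij_betw W {0..d ^ (n - t) - 1} (windows d n t)"
begin

text \<open>The \<open>(n - t)\<close>-digit prefix common to the outputs of \<open>W w\<close>.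
  Since \<open>W\<close> yields windows as bare sets, the prefix is recovered by inverting
  \<open>window\<close>.\<close>

definition key :: "nat \<Rightarrow> nat list" where
  "key w = inv_into (strings d (n - t)) (window d n t) (W w)"

lemma bij_key: "bij_betw key {0..d ^ (n - t) - 1} (strings d (n - t))"
proof -
  have "bij_betw (inv_into (strings d (n - t)) (window d n t)) (windows d n t) (strings d (n - t))"
    unfolding windows_eq using t_less
    by (intro bij_betw_inv_into[OF inj_on_imp_bij_betw[OF inj_on_window[OF d_pos]]]) simp
  from bij_betw_trans[OF bij_W this] show ?thesis
    by (simp add: bij_betw_def inj_on_def key_def image_def)
qed

lemma key_in_strings: "w \<le> d ^ (n - t) - 1 \<Longrightarrow> key w \<in> strings d (n - t)"
  using bij_betwE[OF bij_key] by auto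

lemma W_eq_window: "w \<le> d ^ (n - t) - 1 \<Longrightarrow> W w = window d n t (key w)"
  using bij_betwE[OF bij_W] f_inv_into_f[of "W w" "window d n t" "strings d (n - t)"]
  by (simp add: key_def windows_eq)

lemma key_eq_iff:
  "w \<le> d ^ (n - t) - 1 \<Longrightarrow> w' \<le> d ^ (n - t) - 1 \<Longrightarrow> key w = key w' \<longleftrightarrow> w = w'"
  using bij_betw_imp_inj_on[OF bij_key] by (auto simp: inj_on_def)

lemma W_subset: "w \<le> d ^ (n - t) - 1 \<Longrightarrow> W w \<subseteq> strings d n"
  by (auto simp: W_eq_window window_def)

lemma card_W: "w \<le> d ^ (n - t) - 1 \<Longrightarrow> card (W w) = d ^ t"
  using t_less by (simp add: W_eq_window card_window key_in_strings)

lemma finite_W: "w \<le> d ^ (n - t) - 1 \<Longrightarrow> finite (W w)"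
  using W_subset finite_strings finite_subset by blast

lemma W_disjoint:
  "w \<le> d ^ (n - t) - 1 \<Longrightarrow> w' \<le> d ^ (n - t) - 1 \<Longrightarrow> v \<in> W w \<Longrightarrow> v \<in> W w' \<Longrightarrow> w = w'"
  using key_eq_iff[of w w'] by (auto simp: W_eq_window window_def)

lemma ex_window: "v \<in> strings d n \<Longrightarrow> \<exists>w \<le> d ^ (n - t) - 1. v \<in> W w"
proof -
  assume v: "v \<in> strings d n"
  then have "take (n - t) v \<in> strings d (n - t)" by (simp add: take_in_strings)
  then obtain w where "w \<le> d ^ (n - t) - 1" "key w = take (n - t) v"
    using bij_betw_imp_surj_on[OF bij_key] by (metis atLeastAtMost_iff imageE)
  then show ?thesis using v by (intro exI[of _ w]) (auto simp: W_eq_window window_def)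
qed

lemma finite_win_idx: "finite (win_idx d n t)"
  by (simp add: win_idx_def)

lemma win_idx_le: "w \<in> win_idx d n t \<Longrightarrow> w \<le> d ^ (n - t) - 1 \<and> w \<noteq> 0"
  by (auto simp: win_idx_def)

text \<open>Outputs of different windows differ within the first \<open>n - t\<close> digits, so
  these decide the common prefix length, and cutting off the last digit changes nothing even for
  \<open>t = 0\<close>.\<close>

lemma lcp_len_window:
  assumes w: "w \<in> win_idx d n t" and v: "v \<in> W w" and b: "b \<in> W 0"
  shows "lcp_len (take (n - 1) v) (take (n - 1) b) = lcp_len (key w) (key 0)"
proof -
  have vb: "v \<in> strings d n" "b \<in> strings d n"
    and kv: "take (n - t) v = key w" and kb: "take (n - t) b = key 0"
    using v b win_idx_le[OF w] by (auto simp: W_eq_window window_def)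
  have ne: "take (n - t) v \<noteq> take (n - t) b"
    using kv kb key_eq_iff[of w 0] win_idx_le[OF w] by auto
  have "j \<le> n - 1 \<and> take j v = take j b \<longleftrightarrow> j \<le> n - t \<and> take j (key w) = take j (key 0)" for j
  proof -
    have "j < n - t" if "take j v = take j b"
      using take_eq_mono[OF that, of "n - t"] ne by (meson not_le)
    moreover have "take j (key w) = take j v \<and> take j (key 0) = take j b" if "j \<le> n - t"
      using that unfolding kv[symmetric] kb[symmetric] by (simp add: min_def)
    ultimately show ?thesis by fastforce
  qed
  moreover have "length (key w) = n - t" "length (key 0) = n - t"
    using key_in_strings[of w] key_in_strings[of 0] win_idx_le[OF w] by (auto dest: length_string)
  ultimately have "j \<le> lcp_len (take (n - 1) v) (take (n - 1) b) \<longleftrightarrow> j \<le> lcp_len (key w) (key 0)" for j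
    using lcp_len_take_ge_iff[OF vb, of j] lcp_len_ge_iff[of j "key w" "key 0"] by auto
  then show ?thesis by (meson order_antisym order_refl)
qed

context
  fixes B assumes B: "B \<subseteq> W 0" "B \<noteq> {}"
begin

text \<open>By \<open>lcp_len_window\<close> all pairs from \<open>W w\<close> and \<open>B\<close>
  give the same length. An element of \<open>B\<close> makes this level occur, and an output in
  \<open>W w\<close> makes it the only one.\<close>

lemma j_win_eq:
  assumes w: "w \<in> win_idx d n t"
  shows "j_win d n B (W w) = lcp_len (key w) (key 0)"
proof -
  obtain b where b: "b \<in> B" using B by blast
  have "card (W w) \<noteq> 0" using card_W[of w] win_idx_le[OF w] d_pos by simp
  then obtain v where v: "v \<in> W w" by fastforce
  have sub: "W w \<subseteq> strings d n - B"
    using W_subset[of w] W_disjoint[of w 0] win_idx_le[OF w] B by blast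
  have L: "lcp_len (take (n - 1) v') (take (n - 1) b') = lcp_len (key w) (key 0)"
    if "v' \<in> W w" "b' \<in> B" for v' b'
    using that w B by (intro lcp_len_window) auto
  show ?thesis
    unfolding j_win_def
  proof (rule the_equality)
    show "lcp_len (key w) (key 0) \<le> n - 1 \<and> W w \<subseteq> Bset d n B (lcp_len (key w) (key 0))"
      using L sub b v lcp_len_take_le[of n v b] by (auto simp: Bset_def)
  next
    fix j assume "j \<le> n - 1 \<and> W w \<subseteq> Bset d n B j"
    then have "v \<in> Bset d n B j" using v by blast
    then show "j = lcp_len (key w) (key 0)" using L v by (auto simp: Bset_def)
  qed
qed

text \<open>Through \<open>key\<close> the windows are counted as prefixes that agree with
  \<open>key 0\<close> in \<open>j\<close> digits; the subtracted 1 is window 0.\<close>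

lemma card_j_win_ge:
  assumes j: "j \<le> n - t"
  shows "card {w \<in> win_idx d n t. j \<le> j_win d n B (W w)} = d ^ (n - t - j) - 1"
proof -
  let ?I = "{0..d ^ (n - t) - 1}"
  let ?X = "{s \<in> strings d (n - t). take j s = take j (key 0)}"
  have k0: "key 0 \<in> strings d (n - t)" by (rule key_in_strings) simp
  have mem: "j \<le> j_win d n B (W w) \<longleftrightarrow> key w \<in> ?X" if w: "w \<in> win_idx d n t" for w
  proof -
    have "key w \<in> strings d (n - t)" using win_idx_le[OF w] by (simp add: key_in_strings)
    then show ?thesis
      using j length_string[of "key w"] length_string[OF k0]
      unfolding j_win_eq[OF w] lcp_len_ge_iff by simp
  qed
  have "win_idx d n t = ?I - {0}" by (auto simp: win_idx_def)
  then have "{w \<in> win_idx d n t. j \<le> j_win d n B (W w)} = {w \<in> ?I. key w \<in> ?X} - {0}"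
    using mem by blast
  moreover have "card {w \<in> ?I. key w \<in> ?X} = card ?X"
  proof -
    have "key ` {w \<in> ?I. key w \<in> ?X} = key ` ?I \<inter> ?X" by blast
    also have "\<dots> = ?X" unfolding bij_betw_imp_surj_on[OF bij_key] by blast
    finally have image: "key ` {w \<in> ?I. key w \<in> ?X} = ?X" .
    have "inj_on key {w \<in> ?I. key w \<in> ?X}"
      by (rule inj_on_subset[OF bij_betw_imp_inj_on[OF bij_key]]) auto
    from card_image[OF this] show ?thesis unfolding image by (rule sym)
  qed
  moreover have "card ?X = d ^ (n - t - j)"
    using j k0 by (intro card_strings_prefix take_in_strings) auto
  moreover have "0 \<in> {w \<in> ?I. key w \<in> ?X}" using k0 by simp
  ultimately show ?thesis by simp
qed

lemma j_win_less:
  assumes "w \<in> win_idx d n t"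
  shows "j_win d n B (W w) < n - t"
proof -
  \<comment> \<open>At the threshold \<open>n - t\<close> the count is
    \<open>d ^ 0 - 1 = 0\<close>.\<close>
  have "card {w \<in> win_idx d n t. n - t \<le> j_win d n B (W w)} = 0"
    by (subst card_j_win_ge) auto
  then show ?thesis using assms finite_win_idx by (auto simp: not_le)
qed

lemma sum_j_win_interval:
  assumes "x \<le> y + 1" "y + 1 \<le> n - t"
  shows "(\<Sum>w\<in>win_idx d n t. of_bool (x \<le> j_win d n B (W w) \<and> j_win d n B (W w) \<le> y))
     = real d ^ (n - t - x) - real d ^ (n - t - 1 - y)"
proof -
  have "d ^ k \<ge> 1" for k using d_pos by simp
  then have "real (d ^ k - 1) = real d ^ k - 1" for k by (simp add: of_nat_diff)
  moreover have "n - t - (y + 1) = n - t - 1 - y" by simp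
  ultimately show ?thesis
    using sum_of_bool_interval[OF finite_win_idx assms(1), of "\<lambda>w. j_win d n B (W w)"] assms
      card_j_win_ge[of x] card_j_win_ge[of "y + 1"]
    by simp
qed

text \<open>\<open>B\<close> meets at most \<open>min (card B) (d ^ (q - (n - t)))\<close> of the
  \<open>q\<close>-digit prefixes in \<open>W 0\<close>. Multiplied by \<open>d ^ (n - q)\<close>
  and reduced by \<open>card B\<close>, the two entries of this minimum become those of
  \<open>mu\<close>; equality holds once \<open>B\<close> meets that many prefixes.\<close>

lemma card_Union_Bset_le:
  assumes q: "n - t \<le> q" "q \<le> n"
  shows "card (take q ` W 0) = d ^ (q - (n - t))"
    and "int (card (\<Union>j \<in> {q..n - 1}. Bset d n B j)) \<le> mu d n t (card B) q"
    and "card (take q ` B) = min (card B) (card (take q ` W 0)) \<Longrightarrow>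
      int (card (\<Union>j \<in> {q..n - 1}. Bset d n B j)) = mu d n t (card B) q"
    and "(\<Union>j \<in> {q..n - 1}. Bset d n B j) \<subseteq> W 0 - B"
proof -
  let ?U = "\<lambda>B. \<Union>j \<in> {q..n - 1}. Bset d n B j"
  have n: "1 \<le> n" using t_less by simp
  have Ws: "W 0 \<subseteq> strings d n" by (rule W_subset) simp
  have Bs: "B \<subseteq> strings d n" using Ws B by blast
  have sub: "?U C \<subseteq> W 0 - C" if C: "C \<subseteq> W 0" for C
  proof
    fix v assume "v \<in> ?U C"
    then obtain b where "v \<in> strings d n - C" "b \<in> W 0" "take q v = take q b"
      using C Ws by (subst (asm) Union_Bset_eq) (use q n in auto)
    then show "v \<in> W 0 - C"
      using take_eq_mono[of q v b "n - t"] q by (auto simp: W_eq_window window_def)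
  qed
  then show "?U B \<subseteq> W 0 - B" using B by blast
  have dd: "d ^ (q - (n - t)) * d ^ (n - q) = d ^ t"
    using q t_less by (simp add: power_add[symmetric])
  have pos: "0 < d ^ (n - q)" using d_pos by simp
  \<comment> \<open>With \<open>W 0\<close> in place of \<open>B\<close> the union is empty, so
    \<open>card_Union_Bset\<close> counts the prefixes occurring in \<open>W 0\<close>.\<close>
  have "card (?U (W 0)) = 0" using sub[of "W 0"] by simp
  then have "card (take q ` W 0) * d ^ (n - q) = d ^ t"
    using card_Union_Bset[OF Ws q(2) n] card_W[of 0] by simp
  then show cW: "card (take q ` W 0) = d ^ (q - (n - t))"
    using dd pos by (metis mult_right_cancel not_gr0)
  have finB: "finite B" using B finite_W[of 0] finite_subset by blast
  have main: "card (?U B) + card B = card (take q ` B) * d ^ (n - q)"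
    using card_Union_Bset[OF Bs q(2) n] .
  have mu: "mu d n t (card B) q = int (min (card B) (card (take q ` W 0)) * d ^ (n - q)) - int (card B)"
  proof -
    have "min (card B) (card (take q ` W 0)) * d ^ (n - q) = min (card B * d ^ (n - q)) (d ^ t)"
      unfolding cW dd[symmetric] by (simp add: nat_mult_min_left)
    moreover have "mu d n t (card B) q = int (min (card B * d ^ (n - q)) (d ^ t)) - int (card B)"
      unfolding mu_def of_nat_min min_diff_distrib_left
      by (simp add: right_diff_distrib min.commute)
    ultimately show ?thesis by simp
  qed
  have "card (take q ` B) \<le> min (card B) (card (take q ` W 0))"
    using B finB finite_W[of 0] by (auto intro: card_image_le card_mono)
  then have "card (take q ` B) * d ^ (n - q) \<le> min (card B) (card (take q ` W 0)) * d ^ (n - q)"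
    by (rule mult_right_mono) simp
  then show "int (card (?U B)) \<le> mu d n t (card B) q"
    using main mu by linarith
  show "int (card (?U B)) = mu d n t (card B) q"
    if "card (take q ` B) = min (card B) (card (take q ` W 0))"
  proof -
    have "mu d n t (card B) q = int (card (take q ` B) * d ^ (n - q)) - int (card B)"
      using mu that by simp
    then show ?thesis using main by linarith
  qed
qed

end

end

section \<open>The dual solution\<close>

text \<open>Each summand equals \<open>(D ^ N - D ^ (N - 1)) - (D ^ (N - j + p) - D ^ (N - 1 - j +
  p))\<close>: the first bracket is constant and the second telescopes. The factors will be the
  number of windows at level \<open>j\<close> and the number of inputs paired with each of
  them.\<close>

lemma level_sum:
  fixes D :: real
  assumes "p \<le> h" "h < N"
  shows "(\<Sum>j=p+1..h. (D ^ (N - j) - D ^ (N - 1 - j)) * (D ^ j - D ^ p)) =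
    real (h - p) * (D ^ N - D ^ (N - 1)) - D ^ (N - 1) + D ^ (N - 1 - h + p)"
  using assms
proof (induction h rule: dec_induct)
  case base
  then show ?case by simp
next
  case (step h)
  \<comment> \<open>Writing \<open>N\<close> through \<open>r\<close> turns the truncated
    differences into sums.\<close>
  obtain r where r: "N = h + 2 + r" using step.prems less_iff_Suc_add by auto
  have "(\<Sum>j=p+1..Suc h. (D ^ (N - j) - D ^ (N - 1 - j)) * (D ^ j - D ^ p)) =
    real (h - p) * (D ^ N - D ^ (N - 1)) - D ^ (N - 1) + D ^ (N - 1 - h + p)
      + (D ^ (N - Suc h) - D ^ (N - 1 - Suc h)) * (D ^ Suc h - D ^ p)"
    using step by simp
  also have "\<dots> = real (Suc h - p) * (D ^ N - D ^ (N - 1)) - D ^ (N - 1) + D ^ (N - 1 - Suc h + p)"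
  proof -
    have e: "N - 1 = h + 1 + r" "N - 1 - h + p = r + 1 + p" "N - Suc h = r + 1"
      "N - 1 - Suc h = r" "real (Suc h - p) = real (h - p) + 1"
      using r step.hyps by auto
    show ?thesis unfolding e unfolding r by (simp add: power_add algebra_simps)
  qed
  finally show ?case .
qed

lemma mu_lower:
  assumes "1 \<le> k" "0 < d" "t \<le> n"
  shows "mu d n t k (n - t) = int d ^ t - int k"
proof -
  have "1 * int d ^ t \<le> int k * int d ^ t" using assms by (intro mult_right_mono) auto
  then show ?thesis using assms by (simp add: mu_def right_diff_distrib)
qed

context window_numbering
begin

context
  fixes B assumes B: "B \<subseteq> W 0" "B \<noteq> {}"
begin

lemma finite_B: "finite B"
  using B finite_W[of 0] finite_subset by blast

lemma card_B_pos: "1 \<le> card B"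
  using B finite_B by (simp add: Suc_le_eq card_gt_0_iff)

lemma finite_beta_idx: "finite (beta_idx d n t W a B)"
  by (rule finite_subset[of _ "Aall d n a \<times> win_idx d n t"])
     (auto simp: beta_idx_def finite_Aall finite_win_idx)

text \<open>A window at level \<open>j\<close> with \<open>p < j <= h\<close> is paired with
  \<open>d ^ j - d ^ p\<close> inputs; grouping the windows by level leaves
  \<open>level_sum\<close>. The two uses have \<open>h = n - t - 1\<close> and
  \<open>h = t\<close>.\<close>

lemma beta_sum:
  assumes a: "a \<in> strings d n" and p: "p \<le> h" and h: "h < n - t"
  shows "(\<Sum>(u, w)\<in>beta_idx d n t W a B.
      of_bool (p + 1 \<le> j_win d n B (W w) \<and> j_win d n B (W w) \<le> h \<and>
        n - j_win d n B (W w) \<le> i_of d n a u \<and> i_of d n a u \<le> n - p - 1)) =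
    real (h - p) * (real d ^ (n - t) - real d ^ (n - t - 1))
      - real d ^ (n - t - 1) + real d ^ (n - t - 1 - h + p)"
proof -
  let ?D = "real d"
  define J where "J w = j_win d n B (W w)" for w
  define I where "I u = i_of d n a u" for u
  let ?g = "\<lambda>u w. of_bool (p + 1 \<le> J w \<and> J w \<le> h \<and> n - J w \<le> I u \<and> I u \<le> n - p - 1) :: real"
  \<comment> \<open>The condition \<open>n - J w <= I u\<close> already contains the restriction of
    \<open>beta_idx\<close>, so the sum may run over the full product.\<close>
  have "(\<Sum>(u, w)\<in>beta_idx d n t W a B. ?g u w) = (\<Sum>(u, w)\<in>Aall d n a \<times> win_idx d n t. ?g u w)"
    using h
    by (intro sum.mono_neutral_left)
       (auto simp: beta_idx_def J_def I_def finite_Aall finite_win_idx)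
  also have "\<dots> = (\<Sum>w\<in>win_idx d n t. \<Sum>u\<in>Aall d n a. ?g u w)"
    by (subst sum.swap) (simp add: sum.cartesian_product)
  \<comment> \<open>Equality of \<open>j\<close> and \<open>J w\<close> is written as a degenerate
    interval, the shape that \<open>sum_j_win_interval\<close> evaluates; at most one
    \<open>j\<close> contributes.\<close>
  also have "\<dots> = (\<Sum>w\<in>win_idx d n t. \<Sum>j=p+1..h. of_bool (j \<le> J w \<and> J w \<le> j) * (?D ^ j - ?D ^ p))"
  proof (rule sum.cong[OF refl])
    fix w
    have "(\<Sum>j=p+1..h. of_bool (j \<le> J w \<and> J w \<le> j) * (?D ^ j - ?D ^ p))
        = (\<Sum>j=p+1..h. if J w = j then ?D ^ j - ?D ^ p else 0)"
      by (intro sum.cong) auto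
    also have "\<dots> = (if J w \<in> {p+1..h} then ?D ^ J w - ?D ^ p else 0)"
      by (simp add: sum.delta')
    also have "\<dots> = (\<Sum>u\<in>Aall d n a. ?g u w)"
    proof (cases "J w \<in> {p+1..h}")
      case True
      then have "(\<Sum>u\<in>Aall d n a. ?g u w) =
          (\<Sum>u\<in>Aall d n a. of_bool (n - J w \<le> i_of d n a u \<and> i_of d n a u \<le> n - p - 1))"
        by (simp add: I_def)
      also have "\<dots> = ?D ^ J w - ?D ^ p"
        using True h by (intro sum_i_of_interval a d_pos) auto
      finally show ?thesis using True by simp
    qed auto
    finally show "(\<Sum>u\<in>Aall d n a. ?g u w)
        = (\<Sum>j=p+1..h. of_bool (j \<le> J w \<and> J w \<le> j) * (?D ^ j - ?D ^ p))" by simp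
  qed
  also have "\<dots> = (\<Sum>j=p+1..h. (\<Sum>w\<in>win_idx d n t. of_bool (j \<le> J w \<and> J w \<le> j)) * (?D ^ j - ?D ^ p))"
    by (subst sum.swap) (simp add: sum_distrib_right)
  also have "\<dots> = (\<Sum>j=p+1..h. (?D ^ (n - t - j) - ?D ^ (n - t - 1 - j)) * (?D ^ j - ?D ^ p))"
    unfolding J_def using h by (intro sum.cong refl) (subst sum_j_win_interval[OF B], auto)
  also have "\<dots> = real (h - p) * (?D ^ (n - t) - ?D ^ (n - t - 1))
      - ?D ^ (n - t - 1) + ?D ^ (n - t - 1 - h + p)"
    using p h by (rule level_sum)
  finally show ?thesis unfolding J_def I_def .
qed

text \<open>The five sums are evaluated one by one. Only the \<open>delta\<close> sum depends on
  more of \<open>B\<close> than its size, so the value is \<open>c_bound\<close> with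
  \<open>mu\<close> exchanged for the true number of outputs.\<close>

lemma dual_objective_eq:
  assumes a: "a \<in> strings d n" and p: "p \<le> n - t - 1" and q: "n - t \<le> q" "q \<le> n"
  shows "dual_objective d n t f W a B (dual_solution d n t W a B p q) =
    of_int (c_bound d n t f (card B) p q) - of_int (mu d n t (card B) q)
      + real (card (\<Union>j \<in> {q..n - 1}. Bset d n B j))"
proof -
  let ?D = "real d" and ?s = "dual_solution d n t W a B p q"
  let ?U = "\<Union>j \<in> {q..n - 1}. Bset d n B j"
  have U: "?U \<subseteq> W 0 - B" by (rule card_Union_Bset_le(4)[OF B q])
  have "(\<Sum>v\<in>W 0 - B. delta ?s v) = real (card ((W 0 - B) \<inter> ?U))"
    using finite_W[of 0] by (simp add: dual_solution_def Int_def del: UN_iff)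
  also have "(W 0 - B) \<inter> ?U = ?U" using U by blast
  finally have delta: "(\<Sum>v\<in>W 0 - B. delta ?s v) = real (card ?U)" .
  have eps: "(\<Sum>u\<in>Aall d n a. real f * epsilon ?s u) = real f * (?D ^ p - 1)"
    using p t_less sum_i_of_ge[OF d_pos a, of p]
    by (simp add: dual_solution_def sum_distrib_left[symmetric] del: sum_of_bool_eq)
  have gamma: "(\<Sum>u\<in>Aall d n a. gamma ?s u) = (if q = n - t then 0 else ?D ^ (q - 1) - ?D ^ p)"
  proof (cases "q = n - t")
    case False
    then have "n - q + 1 = n - (q - 1)" "q \<ge> n - t + 1" using q t_less by auto
    then have "(\<Sum>u\<in>Aall d n a. gamma ?s u) =
        (\<Sum>u\<in>Aall d n a. of_bool (n - (q - 1) \<le> i_of d n a u \<and> i_of d n a u \<le> n - p - 1))"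
      by (simp add: dual_solution_def del: sum_of_bool_eq)
    also have "\<dots> = ?D ^ (q - 1) - ?D ^ p"
      using p q t_less False by (intro sum_i_of_interval a d_pos) auto
    finally show ?thesis using False by simp
  qed (use t_less in \<open>simp add: dual_solution_def\<close>)
  \<comment> \<open>\<open>x\<close> is the lowest level with \<open>alpha = 1\<close>, namely
    \<open>t + 1\<close> or \<open>p + 1\<close> in the cases below. For \<open>x = n - t\<close>
    the range is empty and the value is 0.\<close>
  have alpha: "(\<Sum>w\<in>win_idx d n t. real (d ^ t) * of_bool (x \<le> j_win d n B (W w) \<and> j_win d n B (W w) \<le> n - t - 1))
      = ?D ^ (n - x) - ?D ^ t" if "x \<le> n - t" for x
  proof -
    have "(\<Sum>w\<in>win_idx d n t. of_bool (x \<le> j_win d n B (W w) \<and> j_win d n B (W w) \<le> n - t - 1))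
      = ?D ^ (n - t - x) - 1"
      using that t_less by (subst sum_j_win_interval[OF B]) auto
    then have "(\<Sum>w\<in>win_idx d n t. real (d ^ t) * of_bool (x \<le> j_win d n B (W w) \<and> j_win d n B (W w) \<le> n - t - 1))
      = ?D ^ t * (?D ^ (n - t - x) - 1)"
      by (simp only: sum_distrib_left[symmetric] of_nat_power)
    also have "\<dots> = ?D ^ (n - x) - ?D ^ t"
    proof -
      have "n - x = t + (n - t - x)" using that t_less by simp
      then show ?thesis by (simp add: power_add right_diff_distrib)
    qed
    finally show ?thesis .
  qed
  \<comment> \<open>The branches of \<open>c_bound\<close> for \<open>q = n - t\<close> do not
    mention \<open>mu\<close>; this value identifies it in them, in the last two cases after
    \<open>d ^ t\<close> has cancelled against the \<open>alpha\<close> part.\<close>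
  have mu: "mu d n t (card B) q = int d ^ t - int (card B)" if "q = n - t"
    unfolding that using t_less by (intro mu_lower card_B_pos d_pos) simp
  note obj = dual_objective_def delta eps gamma
  consider (high) "n div 2 \<le> t" | (mid) "t < n div 2" "p + 1 \<le> t" | (low) "t < n div 2" "t \<le> p"
    by linarith
  then show ?thesis
  proof cases
    case high
    have "(\<Sum>w\<in>win_idx d n t. real (d ^ t) * alpha ?s w) = 0"
      using high by (simp add: dual_solution_def)
    moreover have "(\<Sum>(u, w)\<in>beta_idx d n t W a B. beta ?s u w) =
        real (n - t - 1 - p) * (?D ^ (n - t) - ?D ^ (n - t - 1)) - ?D ^ (n - t - 1) + ?D ^ p"
      using high p t_less beta_sum[OF a, of p "n - t - 1"]
      by (simp add: dual_solution_def Let_def del: sum_of_bool_eq)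
    ultimately show ?thesis using high mu unfolding obj by (simp add: c_bound_def Let_def)
  next
    case mid
    have "(\<Sum>w\<in>win_idx d n t. real (d ^ t) * alpha ?s w) = ?D ^ (n - t - 1) - ?D ^ t"
      using mid alpha[of "t + 1"] by (simp add: dual_solution_def Let_def del: sum_of_bool_eq)
    moreover have "(\<Sum>(u, w)\<in>beta_idx d n t W a B. beta ?s u w) =
        real (t - p) * (?D ^ (n - t) - ?D ^ (n - t - 1)) - ?D ^ (n - t - 1) + ?D ^ (n + p - 2 * t - 1)"
    proof -
      have "n - t - 1 - t + p = n + p - 2 * t - 1" using mid by linarith
      then show ?thesis
        using mid beta_sum[OF a, of p t] by (simp add: dual_solution_def Let_def del: sum_of_bool_eq)
    qed
    ultimately show ?thesis using mid mu unfolding obj by (simp add: c_bound_def Let_def)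
  next
    case low
    have "(\<Sum>w\<in>win_idx d n t. real (d ^ t) * alpha ?s w) = ?D ^ (n - p - 1) - ?D ^ t"
      using low p t_less alpha[of "p + 1"] by (simp add: dual_solution_def Let_def del: sum_of_bool_eq)
    moreover have "(\<Sum>(u, w)\<in>beta_idx d n t W a B. beta ?s u w) = 0"
      using low by (simp add: dual_solution_def case_prod_unfold)
    ultimately show ?thesis using low mu unfolding obj by (simp add: c_bound_def Let_def)
  qed
qed

section \<open>Feasibility of the dual solution\<close>

lemma Bset_finite_nonempty:
  assumes "v \<in> W 0 - B"
  shows "finite {j. j \<le> n - 1 \<and> v \<in> Bset d n B j}"
    and "b \<in> B \<Longrightarrow> lcp_len (take (n - 1) v) (take (n - 1) b) \<in> {j. j \<le> n - 1 \<and> v \<in> Bset d n B j}"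
  using assms W_subset[of 0] lcp_len_take_le[of n v b] by (auto simp: Bset_def)

lemma lcp_len_le_j_out:
  assumes "v \<in> W 0 - B" "b \<in> B"
  shows "lcp_len (take (n - 1) v) (take (n - 1) b) \<le> j_out d n B v"
  unfolding j_out_def using Bset_finite_nonempty[OF assms(1)] assms(2) by (intro Max_ge) auto

lemma j_out_in:
  assumes "v \<in> W 0 - B"
  shows "j_out d n B v \<le> n - 1 \<and> v \<in> Bset d n B (j_out d n B v)"
proof -
  obtain b where "b \<in> B" using B by blast
  then have "{j. j \<le> n - 1 \<and> v \<in> Bset d n B j} \<noteq> {}" using Bset_finite_nonempty(2)[OF assms] by blast
  from Max_in[OF Bset_finite_nonempty(1)[OF assms] this] show ?thesis
    unfolding j_out_def by simp
qed

lemma W0_Diff_subset_Union_Bset: "W 0 - B \<subseteq> (\<Union>j \<in> {n - t..n - 1}. Bset d n B j)"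
proof -
  have "B \<subseteq> strings d n" using B W_subset[of 0] by blast
  moreover have "\<exists>b\<in>B. take (n - t) v = take (n - t) b" if "v \<in> W 0" for v
  proof -
    obtain b where "b \<in> B" using B by blast
    moreover from this have "b \<in> W 0" using B by blast
    ultimately show ?thesis using that by (intro bexI[of _ b]) (auto simp: W_eq_window window_def)
  qed
  ultimately show ?thesis
    using W_subset[of 0] t_less by (subst Union_Bset_eq) auto
qed

text \<open>If \<open>epsilon\<close> is 0 then \<open>i < n - p\<close>, so a window constraint has
  \<open>j > p\<close> and is met by \<open>beta\<close> or \<open>alpha\<close>, split at level
  \<open>t\<close> in the middle case. An output in \<open>W 0 - B\<close> either shares
  \<open>q\<close> digits with \<open>B\<close>, where \<open>delta\<close> is 1, or has
  \<open>j < q\<close>, whence \<open>i >= n - q + 1\<close> and \<open>gamma\<close> or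
  \<open>epsilon\<close> is 1.\<close>

lemma dual_feasible_solution:
  assumes q: "n - t \<le> q"
  shows "dual_feasible d n t W a B (dual_solution d n t W a B p q)"
proof -
  let ?s = "dual_solution d n t W a B p q"
  have "1 \<le> alpha ?s w + beta ?s u w + epsilon ?s u"
    if w: "w \<in> win_idx d n t" and ij: "n \<le> i_of d n a u + j_win d n B (W w)" for u w
    using ij j_win_less[OF B w] by (auto simp: dual_solution_def Let_def)
  moreover have "1 \<le> gamma ?s u + delta ?s v + epsilon ?s u"
    if v: "v \<in> W 0 - B" and ij: "n \<le> i_of d n a u + j_out d n B v" for u v
  proof (cases "v \<in> (\<Union>j \<in> {q..n - 1}. Bset d n B j)")
    case True
    then have "delta ?s v = 1" by (simp add: dual_solution_def)
    then show ?thesis by (simp add: dual_solution_def)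
  next
    case False
    \<comment> \<open>For \<open>q = n - t\<close> all of \<open>W 0 - B\<close> is covered by
      \<open>delta\<close>; so here \<open>q > n - t\<close>, where \<open>gamma\<close> is switched
      on.\<close>
    have "q \<noteq> n - t" using False v W0_Diff_subset_Union_Bset by blast
    moreover have "j_out d n B v < q" using False j_out_in[OF v] by (meson UN_I atLeastAtMost_iff not_le)
    ultimately have "1 \<le> gamma ?s u + epsilon ?s u"
      using q ij j_out_in[OF v] by (auto simp: dual_solution_def)
    moreover have "0 \<le> delta ?s v" by (simp add: dual_solution_def)
    ultimately show ?thesis by linarith
  qed
  ultimately show ?thesis
    unfolding dual_feasible_def by (auto simp: dual_solution_def Let_def)
qed

end

end

section \<open>Weak duality\<close>

text \<open>Each \<open>x\<close> enters as often as its fibre is large. The multiplicity will be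
  \<open>d ^ t\<close> for \<open>alpha\<close> and \<open>f\<close> for
  \<open>epsilon\<close>.\<close>

lemma sum_fibers_le:
  fixes h :: "'b \<Rightarrow> real"
  assumes "finite R" "finite X" "g ` R \<subseteq> X" "\<And>x. x \<in> X \<Longrightarrow> 0 \<le> h x"
    and "\<And>x. x \<in> X \<Longrightarrow> card {r \<in> R. g r = x} \<le> c"
  shows "(\<Sum>r\<in>R. h (g r)) \<le> (\<Sum>x\<in>X. real c * h x)"
proof -
  have "(\<Sum>r\<in>R. h (g r)) = (\<Sum>x\<in>X. \<Sum>r\<in>{r \<in> R. g r = x}. h (g r))"
    using assms(1-3) by (rule sum.group[symmetric])
  also have "\<dots> = (\<Sum>x\<in>X. real (card {r \<in> R. g r = x}) * h x)"
    by (rule sum.cong) simp_all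
  also have "\<dots> \<le> (\<Sum>x\<in>X. real c * h x)"
    using assms(4,5) by (intro sum_mono mult_right_mono) auto
  finally show ?thesis .
qed

text \<open>The case of multiplicity one, for \<open>beta\<close>, \<open>gamma\<close> and
  \<open>delta\<close>.\<close>

lemma sum_inj_le:
  fixes h :: "'b \<Rightarrow> real"
  assumes "finite X" "inj_on g R" "g ` R \<subseteq> X" "\<And>x. x \<in> X \<Longrightarrow> 0 \<le> h x"
  shows "(\<Sum>r\<in>R. h (g r)) \<le> (\<Sum>x\<in>X. h x)"
proof -
  have "(\<Sum>r\<in>R. h (g r)) = sum h (g ` R)" using assms(2) by (simp add: sum.reindex)
  also have "\<dots> \<le> sum h X" using assms by (intro sum_mono2) auto
  finally show ?thesis .
qed

context window_numbering
begin

text \<open>Weak duality, with \<open>R\<close> standing for the blocked planes and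
  \<open>(u r, v r)\<close> for the conflicting pair chosen on plane \<open>r\<close>. Once the
  selected constraints are added up, only multiplicities remain to be bounded.\<close>

lemma card_le_dual_objective:
  fixes u v :: "'r \<Rightarrow> nat list"
  assumes B: "B \<subseteq> W 0" "B \<noteq> {}"
    and feas: "dual_feasible d n t W a B s"
    and inj_v: "inj_on v R"
    and u: "\<And>r. r \<in> R \<Longrightarrow> u r \<in> strings d n \<and> u r \<noteq> a"
    and v: "\<And>r. r \<in> R \<Longrightarrow> v r \<in> strings d n - B"
    and share: "\<And>r. r \<in> R \<Longrightarrow> \<exists>b\<in>B. n \<le> lcs_len (take (n - 1) (u r)) (take (n - 1) a)
           + lcp_len (take (n - 1) (v r)) (take (n - 1) b)"
    and same_window: "\<And>r r' w. r \<in> R \<Longrightarrow> r' \<in> R \<Longrightarrow> u r = u r' \<Longrightarrow> w \<le> d ^ (n - t) - 1 \<Longrightarrow>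
      v r \<in> W w \<Longrightarrow> v r' \<in> W w \<Longrightarrow> r = r'"
    and fanout: "\<And>x. card {r \<in> R. u r = x} \<le> f"
  shows "finite R" "real (card R) \<le> dual_objective d n t f W a B s"
proof -
  have "v ` R \<subseteq> strings d n" using v by blast
  then show finR: "finite R"
    using inj_v finite_strings finite_subset finite_imageD by metis
  have "\<exists>w \<le> d ^ (n - t) - 1. v r \<in> W w" if "r \<in> R" for r
    using v[OF that] by (intro ex_window) simp
  then obtain w where w: "\<And>r. r \<in> R \<Longrightarrow> w r \<le> d ^ (n - t) - 1 \<and> v r \<in> W (w r)"
    by metis
  \<comment> \<open>Pairs with \<open>v r\<close> outside \<open>W 0\<close> select constraints of
    the first family, the others of the second. \<open>epsilon\<close> occurs in both families and
    is therefore summed over all of \<open>R\<close>.\<close>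
  define R1 where "R1 = {r \<in> R. w r \<noteq> 0}"
  define R0 where "R0 = {r \<in> R. w r = 0}"
  have fin: "finite R1" "finite R0" using finR by (auto simp: R1_def R0_def)
  have w1: "w r \<in> win_idx d n t" if "r \<in> R1" for r
    using that w[of r] by (auto simp: R1_def win_idx_def)
  have v0: "v r \<in> W 0 - B" if "r \<in> R0" for r
    using that w[of r] v[of r] by (auto simp: R0_def)
  have uA: "u r \<in> Aall d n a" if "r \<in> R" for r
    using u[OF that] by (simp add: Aall_eq)
  have ij1: "n \<le> i_of d n a (u r) + j_win d n B (W (w r))" if r: "r \<in> R1" for r
  proof -
    have rR: "r \<in> R" using r by (simp add: R1_def)
    obtain b where b: "b \<in> B" "n \<le> lcs_len (take (n - 1) (u r)) (take (n - 1) a)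
           + lcp_len (take (n - 1) (v r)) (take (n - 1) b)" using share[OF rR] by blast
    have "b \<in> W 0" using b B by blast
    from lcp_len_window[OF w1[OF r] _ this] show ?thesis
      using b w[OF rR] u[OF rR] by (simp add: i_of_eq j_win_eq[OF B w1[OF r]])
  qed
  have ij0: "n \<le> i_of d n a (u r) + j_out d n B (v r)" if r: "r \<in> R0" for r
  proof -
    have rR: "r \<in> R" using r by (simp add: R0_def)
    obtain b where b: "b \<in> B" "n \<le> lcs_len (take (n - 1) (u r)) (take (n - 1) a)
           + lcp_len (take (n - 1) (v r)) (take (n - 1) b)" using share[OF rR] by blast
    from lcp_len_le_j_out[OF B v0[OF r] b(1)] show ?thesis
      using b u[OF rR] by (simp add: i_of_eq)
  qed
  have "real (card R) = real (card R1) + real (card R0)"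
  proof -
    have "R = R1 \<union> R0" "R1 \<inter> R0 = {}" by (auto simp: R1_def R0_def)
    then show ?thesis using fin card_Un_disjoint by fastforce
  qed
  also have "\<dots> = (\<Sum>r\<in>R1. 1) + (\<Sum>r\<in>R0. 1)" by simp
  also have "\<dots> \<le> (\<Sum>r\<in>R1. alpha s (w r) + beta s (u r) (w r) + epsilon s (u r))
      + (\<Sum>r\<in>R0. gamma s (u r) + delta s (v r) + epsilon s (u r))"
  proof (intro add_mono sum_mono)
    fix r assume "r \<in> R1"
    then show "1 \<le> alpha s (w r) + beta s (u r) (w r) + epsilon s (u r)"
      using feas w1 ij1 uA by (simp add: dual_feasible_def R1_def)
  next
    fix r assume "r \<in> R0"
    then show "1 \<le> gamma s (u r) + delta s (v r) + epsilon s (u r)"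
      using feas v0[of r] ij0 uA by (simp add: dual_feasible_def R0_def)
  qed
  also have "\<dots> = (\<Sum>r\<in>R1. alpha s (w r)) + (\<Sum>r\<in>R1. beta s (u r) (w r))
      + (\<Sum>r\<in>R0. gamma s (u r)) + (\<Sum>r\<in>R0. delta s (v r)) + (\<Sum>r\<in>R. epsilon s (u r))"
  proof -
    have "R = R1 \<union> R0" "R1 \<inter> R0 = {}" by (auto simp: R1_def R0_def)
    then have "(\<Sum>r\<in>R. epsilon s (u r)) = (\<Sum>r\<in>R1. epsilon s (u r)) + (\<Sum>r\<in>R0. epsilon s (u r))"
      using fin by (simp add: sum.union_disjoint)
    then show ?thesis by (simp add: sum.distrib)
  qed
  also have "\<dots> \<le> dual_objective d n t f W a B s"
    unfolding dual_objective_def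
  proof (intro add_mono)
    show "(\<Sum>r\<in>R1. alpha s (w r)) \<le> (\<Sum>w \<in> win_idx d n t. real (d ^ t) * alpha s w)"
    proof (rule sum_fibers_le[OF fin(1) finite_win_idx])
      fix x assume x: "x \<in> win_idx d n t"
      show "0 \<le> alpha s x" using feas x by (simp add: dual_feasible_def)
      \<comment> \<open>\<open>v\<close> maps the planes charged to window \<open>x\<close>
        injectively into \<open>W x\<close>.\<close>
      have "card {r \<in> R1. w r = x} = card (v ` {r \<in> R1. w r = x})"
        using inj_v by (intro card_image[symmetric] inj_on_subset[OF inj_v]) (auto simp: R1_def)
      also have "\<dots> \<le> card (W x)"
        using win_idx_le[OF x] w by (intro card_mono finite_W) (auto simp: R1_def)
      finally show "card {r \<in> R1. w r = x} \<le> d ^ t" using win_idx_le[OF x] by (simp add: card_W)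
    qed (use w1 in blast)
  next
    have "(\<Sum>r\<in>R1. beta s (u r) (w r)) = (\<Sum>r\<in>R1. (\<lambda>(u, w). beta s u w) (u r, w r))" by simp
    also have "\<dots> \<le> (\<Sum>(u, w) \<in> beta_idx d n t W a B. beta s u w)"
    proof (rule sum_inj_le[OF finite_beta_idx[OF B]])
      show "inj_on (\<lambda>r. (u r, w r)) R1"
      proof (rule inj_onI)
        fix r r' assume rr: "r \<in> R1" "r' \<in> R1" and eq: "(u r, w r) = (u r', w r')"
        then have "r \<in> R" "r' \<in> R" by (auto simp: R1_def)
        then show "r = r'" using same_window[of r r' "w r"] w[of r] w[of r'] eq by auto
      qed
      show "(\<lambda>r. (u r, w r)) ` R1 \<subseteq> beta_idx d n t W a B"
        using w1 uA ij1 by (auto simp: beta_idx_def R1_def)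
    qed (use feas in \<open>auto simp: dual_feasible_def\<close>)
    finally show "(\<Sum>r\<in>R1. beta s (u r) (w r)) \<le> (\<Sum>(u, w) \<in> beta_idx d n t W a B. beta s u w)" .
  next
    show "(\<Sum>r\<in>R0. gamma s (u r)) \<le> (\<Sum>u \<in> Aall d n a. gamma s u)"
    proof (rule sum_inj_le[OF finite_Aall])
      show "inj_on u R0"
      proof (rule inj_onI)
        fix r r' assume "r \<in> R0" "r' \<in> R0" "u r = u r'"
        then show "r = r'" using same_window[of r r' 0] v0[of r] v0[of r'] by (auto simp: R0_def)
      qed
    qed (use feas uA in \<open>auto simp: dual_feasible_def R0_def\<close>)
  next
    show "(\<Sum>r\<in>R0. delta s (v r)) \<le> (\<Sum>v \<in> W 0 - B. delta s v)"
    proof (rule sum_inj_le)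
      show "finite (W 0 - B)" using finite_W[of 0] by simp
      show "inj_on v R0" by (rule inj_on_subset[OF inj_v]) (simp add: R0_def)
    qed (use feas v0 in \<open>auto simp: dual_feasible_def\<close>)
  next
    show "(\<Sum>r\<in>R. epsilon s (u r)) \<le> (\<Sum>u \<in> Aall d n a. real f * epsilon s u)"
      using feas uA fanout
      by (intro sum_fibers_le[OF finR finite_Aall]) (auto simp: dual_feasible_def)
  qed
  finally show "real (card R) \<le> dual_objective d n t f W a B s" .
qed

end

section \<open>Blocked planes\<close>

text \<open>In such a state a source determines its connection, and so does a destination; this
  traces conflicting pairs back to single requests.\<close>

definition legal_state :: "nat \<Rightarrow> nat \<Rightarrow> nat \<Rightarrow> nat \<Rightarrow> connection set \<Rightarrow> bool" where
  "legal_state d n t f S \<longleftrightarrow>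
     (\<forall>c\<in>S. src c \<in> strings d n \<and> dests c \<subseteq> strings d n \<and> card (dests c) \<le> f \<and> window_rule d n t c) \<and>
     (\<forall>c\<in>S. \<forall>c'\<in>S. c \<noteq> c' \<longrightarrow> src c \<noteq> src c' \<and> dests c \<inter> dests c' = {})"

lemma reachable_legal: "reachable d n t f m S \<Longrightarrow> legal_state d n t f S"
proof (induction rule: reachable.induct)
  case idle
  then show ?case by (simp add: legal_state_def)
next
  case (arrival S c)
  then have "\<forall>c'\<in>S. src c' \<noteq> src c \<and> dests c' \<inter> dests c = {} \<and> dests c \<inter> dests c' = {}"
    by (simp add: new_request_def Int_commute)
  then show ?case
    using arrival unfolding legal_state_def ball_simps
    by (simp add: new_request_def routable_def) metis
next
  case (departure S c)
  then show ?case unfolding legal_state_def by blast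
qed

text \<open>All routes into one window must use the same plane, so for \<open>B\<close> inside a
  window a single collision rules a plane out for the whole subrequest.\<close>

definition blocked :: "nat \<Rightarrow> connection set \<Rightarrow> nat list \<Rightarrow> nat list set \<Rightarrow> nat set" where
  "blocked n S a B = {r. \<exists>c\<in>S. \<exists>v\<in>dests c. plane c v = r \<and>
     (\<exists>b\<in>B. path_links (route n a b) \<inter> path_links (route n (src c) v) \<noteq> {})}"

lemma (in window_numbering) card_blocked_le_dual_objective:
  assumes S: "legal_state d n t f S" and a: "a \<in> strings d n"
    and B: "B \<subseteq> W 0" "B \<noteq> {}"
    and new: "\<And>c. c \<in> S \<Longrightarrow> src c \<noteq> a \<and> dests c \<inter> B = {}"
    and feas: "dual_feasible d n t W a B s"
  shows "finite (blocked n S a B)" "real (card (blocked n S a B)) \<le> dual_objective d n t f W a B s"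
proof -
  let ?R = "blocked n S a B"
  have "\<forall>r\<in>?R. \<exists>c v. c \<in> S \<and> v \<in> dests c \<and> plane c v = r \<and>
      (\<exists>b\<in>B. path_links (route n a b) \<inter> path_links (route n (src c) v) \<noteq> {})"
    by (auto simp: blocked_def)
  then obtain c v where cv: "\<And>r. r \<in> ?R \<Longrightarrow> c r \<in> S \<and> v r \<in> dests (c r) \<and> plane (c r) (v r) = r \<and>
      (\<exists>b\<in>B. path_links (route n a b) \<inter> path_links (route n (src (c r)) (v r)) \<noteq> {})"
    by metis
  have str: "src (c r) \<in> strings d n" "v r \<in> strings d n" "v r \<notin> B" if "r \<in> ?R" for r
    using cv[OF that] S new by (auto simp: legal_state_def)
  have same: "c r = c r'" if "r \<in> ?R" "r' \<in> ?R" "src (c r) = src (c r') \<or> v r = v r'" for r r'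
    using cv[OF that(1)] cv[OF that(2)] that(3) S unfolding legal_state_def by (metis disjoint_iff)
  \<comment> \<open>A common destination means a common connection and hence a common plane, since
    \<open>r\<close> is recovered as \<open>plane (c r) (v r)\<close>.\<close>
  have inj: "inj_on v ?R"
  proof (rule inj_onI)
    fix r r' assume "r \<in> ?R" "r' \<in> ?R" "v r = v r'"
    then show "r = r'" using same[of r r'] cv by metis
  qed
  have share: "\<exists>b\<in>B. n \<le> lcs_len (take (n - 1) (src (c r))) (take (n - 1) a)
      + lcp_len (take (n - 1) (v r)) (take (n - 1) b)" if r: "r \<in> ?R" for r
  proof -
    obtain b where b: "b \<in> B" "path_links (route n a b) \<inter> path_links (route n (src (c r)) (v r)) \<noteq> {}"
      using cv[OF r] by blast
    have "b \<in> strings d n" using b B W_subset[of 0] by blast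
    moreover have "v r \<noteq> b" using str[OF r] b by blast
    moreover have "src (c r) \<noteq> a" using cv[OF r] new by blast
    ultimately show ?thesis using shared_link_imp[OF a str(1)[OF r] _ str(2)[OF r] _ _ b(2)] b(1) by blast
  qed
  have same_window: "r = r'"
    if "r \<in> ?R" "r' \<in> ?R" "src (c r) = src (c r')" "w \<le> d ^ (n - t) - 1" "v r \<in> W w" "v r' \<in> W w"
    for r r' w
  proof -
    have eq: "c r = c r'" using same that by blast
    have "W w \<in> windows d n t" using bij_betwE[OF bij_W] that(4) by simp
    moreover have "window_rule d n t (c r)"
      using S cv[OF that(1)] unfolding legal_state_def by blast
    ultimately have "\<exists>p. \<forall>b\<in>dests (c r) \<inter> W w. plane (c r) b = p"
      unfolding window_rule_def by blast
    then have "plane (c r) (v r) = plane (c r') (v r')"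
      using cv[OF that(1)] cv[OF that(2)] that eq by auto
    then show ?thesis using cv[OF that(1)] cv[OF that(2)] by simp
  qed
  \<comment> \<open>All planes charged to \<open>x\<close> come from one connection, and their
    outputs \<open>v r\<close> are distinct destinations of it.\<close>
  have fanout: "card {r \<in> ?R. src (c r) = x} \<le> f" for x
  proof (cases "{r \<in> ?R. src (c r) = x} = {}")
    case False
    then obtain r0 where r0: "r0 \<in> ?R" "src (c r0) = x" by blast
    have sub: "v ` {r \<in> ?R. src (c r) = x} \<subseteq> dests (c r0)"
    proof clarify
      fix r assume "r \<in> ?R" "x = src (c r)"
      then show "v r \<in> dests (c r0)" using same[of r r0] r0 cv[of r] by simp
    qed
    have c0: "dests (c r0) \<subseteq> strings d n" "card (dests (c r0)) \<le> f"
      using S cv[OF r0(1)] by (auto simp: legal_state_def)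
    have "card {r \<in> ?R. src (c r) = x} = card (v ` {r \<in> ?R. src (c r) = x})"
      by (intro card_image[symmetric] inj_on_subset[OF inj]) auto
    also have "\<dots> \<le> card (dests (c r0))"
      using sub c0 finite_strings finite_subset by (intro card_mono) blast+
    finally show ?thesis using c0 by simp
  next
    case True
    show ?thesis unfolding True by simp
  qed
  note bound = card_le_dual_objective[OF B feas inj _ _ share same_window fanout]
  show "finite ?R" by (rule bound(1)) (use str cv new in blast)+
  show "real (card ?R) \<le> dual_objective d n t f W a B s" by (rule bound(2)) (use str cv new in blast)+
qed

section \<open>Free planes and the routing of a new request\<close>

lemma (in window_numbering) dual_objective_le:
  assumes "B \<subseteq> W 0" "B \<noteq> {}" "a \<in> strings d n" "p \<le> n - t - 1" "n - t \<le> q" "q \<le> n"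
  shows "dual_objective d n t f W a B (dual_solution d n t W a B p q)
    \<le> of_int (c_bound d n t f (card B) p q)"
proof -
  have "real (card (\<Union>j \<in> {q..n - 1}. Bset d n B j)) \<le> of_int (mu d n t (card B) q)"
    using card_Union_Bset_le(2)[OF assms(1,2,5,6)] by (metis of_int_le_iff of_int_of_nat_eq)
  then show ?thesis using dual_objective_eq[OF assms(1-6)] by simp
qed

lemma (in window_numbering) ex_free_plane:
  assumes S: "legal_state d n t f S" and a: "a \<in> strings d n"
    and B: "B \<subseteq> W 0" "B \<noteq> {}"
    and new: "\<And>c. c \<in> S \<Longrightarrow> src c \<noteq> a \<and> dests c \<inter> B = {}"
    and pq: "p \<le> n - t - 1" "n - t \<le> q" "q \<le> n"
    and m: "c_bound d n t f (card B) p q < int m"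
  shows "\<exists>r<m. r \<notin> blocked n S a B"
proof (rule ccontr)
  assume "\<not> (\<exists>r<m. r \<notin> blocked n S a B)"
  then have "{..<m} \<subseteq> blocked n S a B" by auto
  note blk = card_blocked_le_dual_objective[OF S a B new dual_feasible_solution[OF B pq(2), where p = p]]
  have "card {..<m} \<le> card (blocked n S a B)"
    using \<open>{..<m} \<subseteq> blocked n S a B\<close> blk(1) by (intro card_mono)
  then have "real m \<le> dual_objective d n t f W a B (dual_solution d n t W a B p q)"
    using blk(2) by simp
  also have "\<dots> \<le> of_int (c_bound d n t f (card B) p q)"
    by (rule dual_objective_le[OF B a pq])
  finally show False using m by linarith
qed

lemma ex_window_numbering:
  assumes "0 < d" "t < n" "V \<in> windows d n t"
  shows "\<exists>W. window_numbering d n t W \<and> W 0 = V"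
proof -
  have fin: "finite (windows d n t)" by (simp add: windows_eq finite_strings)
  have card: "card (windows d n t) = d ^ (n - t)"
    using inj_on_window[of d t n] assms by (simp add: windows_eq card_image card_strings)
  obtain h where h: "bij_betw h {0..<d ^ (n - t)} (windows d n t)"
    using ex_bij_betw_nat_finite[OF fin] card by auto
  obtain e where "d ^ (n - t) = Suc e" 
    using assms(1) not0_implies_Suc[of "d ^ (n - t)"] by auto
  then have I: "{0..<d ^ (n - t)} = {0..d ^ (n - t) - 1}"
    by (simp add: atLeastLessThanSuc_atLeastAtMost)
  obtain x where x: "x \<in> {0..<d ^ (n - t)}" "h x = V"
    using h assms(3) by (metis bij_betw_imp_surj_on imageE)
  \<comment> \<open>Swapping the numbers 0 and \<open>x\<close> makes \<open>V\<close> the window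
    number 0.\<close>
  have "bij_betw (h \<circ> transpose 0 x) {0..<d ^ (n - t)} (windows d n t)"
    using x(1) assms(1) by (intro bij_betw_trans[OF _ h] bij_betw_transpose_iff) auto
  then have "window_numbering d n t (h \<circ> transpose 0 x)"
    unfolding I by unfold_locales (use assms in auto)
  moreover have "(h \<circ> transpose 0 x) 0 = V" using x by simp
  ultimately show ?thesis by blast
qed

text \<open>Each subrequest is put on a plane free for its own window; this is consistent because
  routes with the same source may share links. The parts of the request differ in size, so
  \<open>p\<close> and \<open>q\<close> may depend on the size \<open>k\<close>.\<close>

lemma wsnb_windowI:
  assumes d: "0 < d" and t: "t < n"
    and bound: "\<And>k. 1 \<le> k \<Longrightarrow> k \<le> min f (d ^ t) \<Longrightarrow>
      \<exists>p q. p \<le> n - t - 1 \<and> n - t \<le> q \<and> q \<le> n \<and> c_bound d n t f k p q < int m"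
  shows "wsnb_window d n t f m"
  unfolding wsnb_window_def
proof (intro allI impI)
  fix S a B
  assume reach: "reachable d n t f m S" and req: "new_request d n f S a B"
  have S: "legal_state d n t f S" using reach by (rule reachable_legal)
  have a: "a \<in> strings d n" and B: "B \<subseteq> strings d n" "card B \<le> f"
    and new: "\<And>c. c \<in> S \<Longrightarrow> src c \<noteq> a \<and> dests c \<inter> B = {}"
    using req by (auto simp: new_request_def)
  have finB: "finite B" using B finite_strings finite_subset by blast
  have "\<exists>r<m. r \<notin> blocked n S a (B \<inter> window d n t x)"
    if x: "x \<in> strings d (n - t)" "B \<inter> window d n t x \<noteq> {}" for x
  proof -
    obtain W where W: "window_numbering d n t W" "W 0 = window d n t x"
      using ex_window_numbering[OF d t, of "window d n t x"] x by (auto simp: windows_eq)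
    interpret window_numbering d n t W by (rule W)
    let ?B = "B \<inter> window d n t x"
    have "card ?B \<le> card (window d n t x)"
      using finite_W[of 0] W(2) by (intro card_mono) auto
    moreover have "card ?B \<le> card B" using finB by (intro card_mono) auto
    moreover have "1 \<le> card ?B" using finB x(2) by (simp add: Suc_le_eq card_gt_0_iff)
    ultimately have "1 \<le> card ?B" "card ?B \<le> min f (d ^ t)"
      using B(2) card_W[of 0] W(2) by auto
    from bound[OF this] obtain p q where "p \<le> n - t - 1" "n - t \<le> q" "q \<le> n"
      "c_bound d n t f (card ?B) p q < int m" by blast
    then show ?thesis using new x(2) W(2) by (intro ex_free_plane[OF S a]) auto
  qed
  then obtain g where g: "g x < m \<and> g x \<notin> blocked n S a (B \<inter> window d n t x)"
    if "x \<in> strings d (n - t)" "B \<inter> window d n t x \<noteq> {}" for x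
    by metis
  \<comment> \<open>The plane depends only on the prefix of \<open>b\<close>, which gives the window
    rule.\<close>
  let ?c = "Connection a B (\<lambda>b. g (take (n - t) b))"
  have gB: "g (take (n - t) b) < m \<and> g (take (n - t) b) \<notin> blocked n S a (B \<inter> window d n t (take (n - t) b))"
    and bw: "b \<in> B \<inter> window d n t (take (n - t) b)" if "b \<in> B" for b
  proof -
    have "b \<in> strings d n" using that B by blast
    then show bw: "b \<in> B \<inter> window d n t (take (n - t) b)" using that by (simp add: window_def)
    show "g (take (n - t) b) < m \<and> g (take (n - t) b) \<notin> blocked n S a (B \<inter> window d n t (take (n - t) b))"
      using \<open>b \<in> strings d n\<close> bw by (intro g take_in_strings) auto
  qed
  have "window_rule d n t ?c"
    unfolding window_rule_def windows_eq by (auto simp: window_def)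
  moreover have "conn_links n ?c \<inter> conn_links n c' = {}" if c': "c' \<in> S" for c'
  proof (rule ccontr)
    assume "conn_links n ?c \<inter> conn_links n c' \<noteq> {}"
    then obtain x where x: "x \<in> conn_links n ?c" "x \<in> conn_links n c'" by blast
    obtain b where "b \<in> B" "fst x = g (take (n - t) b)" "snd x \<in> path_links (route n a b)"
      using x(1) by (auto simp: conn_links_def)
    moreover obtain v where "v \<in> dests c'" "fst x = plane c' v"
      "snd x \<in> path_links (route n (src c') v)"
      using x(2) by (auto simp: conn_links_def)
    ultimately have b: "b \<in> B" and "v \<in> dests c'" "plane c' v = g (take (n - t) b)"
      "path_links (route n a b) \<inter> path_links (route n (src c') v) \<noteq> {}"
      by auto
    then have "g (take (n - t) b) \<in> blocked n S a (B \<inter> window d n t (take (n - t) b))"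
      using c' bw[of b] unfolding blocked_def by blast
    then show False using gB[OF b] by blast
  qed
  ultimately have "routable d n t m S ?c" using gB by (simp add: routable_def)
  then show "\<exists>c. src c = a \<and> dests c = B \<and> routable d n t m S c"
    by (intro exI[of _ ?c]) simp
qed

text \<open>For \<open>n - t < q < n\<close> the objective value can depend on how \<open>B\<close>
  is spread over the \<open>q\<close>-digit prefixes, and \<open>c_bound\<close> is the largest
  value over all \<open>B\<close> of size \<open>k\<close>. Hence the form of the first part: an
  upper bound, a criterion for equality, equality at \<open>q = n - t\<close>, and a
  \<open>B\<close> attaining the bound. The upper bound is what the sufficient condition rests
  on.\<close>

theorem theorem4p6:
  fixes d n m t f :: nat and W :: "nat \<Rightarrow> nat list set"
  assumes "d \<ge> 2" and "n \<ge> 1" and "m \<ge> 1"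
    and "t < n" and "1 \<le> f" and "f \<le> d ^ n"
    and "bij_betw W {0..d ^ (n - t) - 1} (windows d n t)"
  shows
    "(\<forall>a \<in> strings d n. \<forall>k p q. 1 \<le> k \<and> k \<le> min f (d ^ t) \<and>
          p \<le> n - t - 1 \<and> n - t \<le> q \<and> q \<le> n \<longrightarrow>
        (\<forall>B. B \<subseteq> W 0 \<and> card B = k \<longrightarrow>
           dual_feasible d n t W a B (dual_solution d n t W a B p q) \<and>
           dual_objective d n t f W a B (dual_solution d n t W a B p q)
             \<le> of_int (c_bound d n t f k p q) \<and>
           (q = n - t \<longrightarrow>
              dual_objective d n t f W a B (dual_solution d n t W a B p q)
                = of_int (c_bound d n t f k p q)) \<and>
           (dual_objective d n t f W a B (dual_solution d n t W a B p q)
                = of_int (c_bound d n t f k p q)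
              \<longleftrightarrow> int (card (\<Union>j \<in> {q..n - 1}. Bset d n B j)) = mu d n t k q)) \<and>
        (\<exists>B. B \<subseteq> W 0 \<and> card B = k \<and>
           dual_objective d n t f W a B (dual_solution d n t W a B p q)
             = of_int (c_bound d n t f k p q)))
     \<and>
     (int m \<ge> 1 + (MAX k \<in> {1..min f (d ^ t)}.
                     MIN (p, q) \<in> {0..n - t - 1} \<times> {n - t..n}. c_bound d n t f k p q)
        \<longrightarrow> wsnb_window d n t f m)"
proof (intro conjI ballI allI impI)
  interpret window_numbering d n t W
    using assms by unfold_locales auto
  fix a k p q
  assume a: "a \<in> strings d n"
    and "1 \<le> k \<and> k \<le> min f (d ^ t) \<and> p \<le> n - t - 1 \<and> n - t \<le> q \<and> q \<le> n"
  then have k: "1 \<le> k" "k \<le> d ^ t" and p: "p \<le> n - t - 1" and q: "n - t \<le> q" "q \<le> n" by auto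
  let ?obj = "\<lambda>B. dual_objective d n t f W a B (dual_solution d n t W a B p q)"
  let ?U = "\<lambda>B. \<Union>j \<in> {q..n - 1}. Bset d n B j"
  have eq_iff: "?obj B = of_int (c_bound d n t f k p q) \<longleftrightarrow> int (card (?U B)) = mu d n t k q"
    if "B \<subseteq> W 0" "card B = k" for B
  proof -
    have "B \<noteq> {}" using that k by auto
    from dual_objective_eq[OF that(1) this a p q, of f]
    have "?obj B = of_int (c_bound d n t f k p q) \<longleftrightarrow> real (card (?U B)) = of_int (mu d n t k q)"
      unfolding that(2) by linarith
    then show ?thesis unfolding of_int_of_nat_eq[where 'a = real, symmetric] of_int_eq_iff .
  qed
  {
    fix B assume "B \<subseteq> W 0 \<and> card B = k"
    then have B: "B \<subseteq> W 0" "card B = k" "B \<noteq> {}" using k by auto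
    show "dual_feasible d n t W a B (dual_solution d n t W a B p q)"
      using B q by (intro dual_feasible_solution)
    show "?obj B \<le> of_int (c_bound d n t f k p q)"
      using dual_objective_le[OF B(1,3) a p q] B(2) by simp
    show "?obj B = of_int (c_bound d n t f k p q) \<longleftrightarrow> int (card (?U B)) = mu d n t k q"
      using B by (intro eq_iff)
    assume "q = n - t"
    then have "?U B = W 0 - B"
      using W0_Diff_subset_Union_Bset[OF B(1,3)] card_Union_Bset_le(4)[OF B(1,3) q] by blast
    then have "card (?U B) = d ^ t - k"
      using B finite_B[OF B(1,3)] by (simp add: card_Diff_subset card_W)
    then have "int (card (?U B)) = mu d n t k q"
      using \<open>q = n - t\<close> k d_pos t_less by (simp add: mu_lower of_nat_diff)
    then show "?obj B = of_int (c_bound d n t f k p q)" using B by (simp add: eq_iff)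
  }
  \<comment> \<open>Spreading \<open>B\<close> over as many \<open>q\<close>-digit prefixes as
    possible attains \<open>mu\<close>.\<close>
  obtain B where B: "B \<subseteq> W 0" "card B = k" "card (take q ` B) = min k (card (take q ` W 0))"
    using ex_subset_card_image[of "W 0" k "take q"] k finite_W[of 0] card_W[of 0] by auto
  have "B \<noteq> {}" using B k by auto
  from card_Union_Bset_le(3)[OF B(1) this q] have "int (card (?U B)) = mu d n t k q"
    using B by simp
  then show "\<exists>B. B \<subseteq> W 0 \<and> card B = k \<and> ?obj B = of_int (c_bound d n t f k p q)"
    using B eq_iff by blast
next
  let ?F = "\<lambda>k. MIN (p, q) \<in> {0..n - t - 1} \<times> {n - t..n}. c_bound d n t f k p q"
  assume m: "int m \<ge> 1 + (MAX k \<in> {1..min f (d ^ t)}. ?F k)"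
  show "wsnb_window d n t f m"
  proof (rule wsnb_windowI)
    fix k assume k: "1 \<le> k" "k \<le> min f (d ^ t)"
    have "?F k \<le> (MAX k \<in> {1..min f (d ^ t)}. ?F k)"
      using k by (intro Max_ge) auto
    then have "?F k < int m" using m by linarith
    \<comment> \<open>The minimum is attained, and the place where it is attained provides
      \<open>p\<close> and \<open>q\<close>.\<close>
    have "?F k \<in> (\<lambda>(p, q). c_bound d n t f k p q) ` ({0..n - t - 1} \<times> {n - t..n})"
      by (intro Min_in) auto
    then obtain x where x: "?F k = (case x of (p, q) \<Rightarrow> c_bound d n t f k p q)"
      "x \<in> {0..n - t - 1} \<times> {n - t..n}" by blast
    obtain p q where "x = (p, q)" by (cases x)
    then have "p \<le> n - t - 1 \<and> n - t \<le> q \<and> q \<le> n \<and> c_bound d n t f k p q < int m"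
      using x \<open>?F k < int m\<close> by simp
    then show "\<exists>p q. p \<le> n - t - 1 \<and> n - t \<le> q \<and> q \<le> n \<and> c_bound d n t f k p q < int m"
      by blast
  qed (use assms in auto)
qed

end
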